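(* Let $\varepsilon,\delta>0$, let $d\geq 4$ be an integer with $d\geq 2\delta^{-2}\varepsilon^{-1}$, let $\mathbb{X}^d=\mathbb{R}^d$ or $\mathbb{X}^d=\mathbb{C}^d$, let $\{b_1,\ldots,b_d\}$ be any orthonormal basis of $\mathbb{X}^d$, let $R$ be a random element of $G$ with distribution $u_G$, and let $\varphi\in L^2(\mathbb{S}(\mathbb{X}^d),u,\mathbb{R})$. Then $$\mathbb{P}\biggl(\Bigl|\frac1d\sum_{j=1}^d\varphi(R(b_j))-\mathbb{E}_u(\varphi)\Bigr|\leq\delta\sqrt{\operatorname{Var}_u(\varphi)}\biggr)\geq 1-\varepsilon.$$
   Context: $\mathbb{X}^d$ denotes $\mathbb{R}^d$ or $\mathbb{C}^d$ with its standard inner product; $\mathbb{S}(\mathbb{X}^d)$ is its unit sphere; $u$ is the uniform probability measure (normalized surface area) on $\mathbb{S}(\mathbb{X}^d)$. $G$ is the orthogonal group $O(d)$ if $\mathbb{X}^d=\mathbb{R}^d$ and the unitary group $U(d)$ if $\mathbb{X}^d=\mathbb{C}^d$; $u_G$ is the normalized Haar measure on $G$. $L^2(\mathbb{S}(\mathbb{X}^d),u,\mathbb{R})$ is the space of real-valued square-integrable functions with respect to $u$; $\mathbb{E}_u(\varphi)$ and $\operatorname{Var}_u(\varphi)$ are the mean and variance of $\varphi$ with respect to $u$. *)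

theory Defs
  imports "HOL-Probability.Probability"
begin

text \<open>
  Surface area on the unit sphere of a Euclidean space, defined through cones over the origin:
  the area of a Borel set \<open>A\<close> is the dimension times the Lebesgue measure of
  \<open>{r x | 0 < r \<le> 1, x \<in> A}\<close> (see \<open>emeasure_sphere_area\<close> below). For the type
  \<open>complex ^ 'n\<close> the dimension is the real one, i.e. twice the cardinality of \<open>'n\<close>.
\<close>

definition sphere_area :: "'a::euclidean_space measure" where
  "sphere_area =
     scale_measure (of_nat DIM('a))
       (restrict_space
         (distr (restrict_space lborel (cball 0 1)) borel (\<lambda>x. x /\<^sub>R norm x))
         (sphere 0 1))"

definition uniform_sphere :: "'a::euclidean_space measure" where
  "uniform_sphere = uniform_measure sphere_area (sphere 0 1)"

lemma space_sphere_area [simp]: "space (sphere_area :: 'a::euclidean_space measure) = sphere 0 1"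
  by (simp add: sphere_area_def space_scale_measure space_restrict_space)

lemma sets_sphere_area [simp, measurable_cong]:
  "sets (sphere_area :: 'a::euclidean_space measure) = sets (restrict_space borel (sphere 0 1))"
  unfolding sphere_area_def sets_scale_measure by (intro sets_restrict_space_cong) simp

lemma space_uniform_sphere [simp]:
  "space (uniform_sphere :: 'a::euclidean_space measure) = sphere 0 1"
  by (simp add: uniform_sphere_def)

lemma sets_uniform_sphere [simp, measurable_cong]:
  "sets (uniform_sphere :: 'a::euclidean_space measure) = sets (restrict_space borel (sphere 0 1))"
  by (simp add: uniform_sphere_def)

lemma emeasure_sphere_area:
  fixes A :: "'a::euclidean_space set"
  assumes A: "A \<in> sets borel" "A \<subseteq> sphere 0 1"
  shows "emeasure sphere_area A =
           of_nat DIM('a) * emeasure lborel {r *\<^sub>R x | r x. 0 < r \<and> r \<le> 1 \<and> x \<in> A}"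
proof -
  let ?f = "\<lambda>x::'a. x /\<^sub>R norm x"
  have eq: "?f -` A \<inter> cball 0 1 = {r *\<^sub>R x | r x. 0 < r \<and> r \<le> 1 \<and> x \<in> A}" (is "?L = ?R")
  proof (intro equalityI subsetI)
    fix y assume y: "y \<in> ?L"
    then have "?f y \<in> sphere 0 1" using A(2) by blast
    then have "y \<noteq> 0" by auto
    then have "y = norm y *\<^sub>R ?f y" "0 < norm y" "norm y \<le> 1" "?f y \<in> A"
      using y by auto
    then show "y \<in> ?R" by blast
  next
    fix y assume "y \<in> ?R"
    then obtain r x where "y = r *\<^sub>R x" "0 < r" "r \<le> 1" "x \<in> A" by blast
    moreover from this A(2) have "norm x = 1" by auto
    ultimately show "y \<in> ?L" by simp
  qed
  have f: "?f \<in> restrict_space lborel (cball 0 1) \<rightarrow>\<^sub>M borel"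
    by (intro measurable_restrict_space1) simp
  have "emeasure (restrict_space (distr (restrict_space lborel (cball 0 1)) borel ?f) (sphere 0 1)) A
      = emeasure (distr (restrict_space lborel (cball 0 1)) borel ?f) A"
    using A(2) by (intro emeasure_restrict_space) auto
  also have "\<dots> = emeasure (restrict_space lborel (cball 0 1)) (?f -` A \<inter> cball 0 1)"
    using A(1) f by (subst emeasure_distr) (auto simp: space_restrict_space)
  also have "\<dots> = emeasure lborel (?f -` A \<inter> cball 0 1)"
    by (intro emeasure_restrict_space) auto
  finally show ?thesis
    by (simp add: sphere_area_def eq)
qed

lemma emeasure_sphere_area_sphere:
  "emeasure (sphere_area :: 'a::euclidean_space measure) (sphere 0 1) =
     of_nat DIM('a) * emeasure lborel (cball (0::'a) 1)"
proof -
  have eq: "{r *\<^sub>R x | r x. 0 < r \<and> r \<le> 1 \<and> x \<in> sphere 0 1} = cball (0::'a) 1 - {0}" (is "?L = ?R")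
  proof (intro equalityI subsetI)
    fix y :: 'a assume "y \<in> ?R"
    then have "y = norm y *\<^sub>R (y /\<^sub>R norm y)" "0 < norm y" "norm y \<le> 1" "y /\<^sub>R norm y \<in> sphere 0 1"
      by auto
    then show "y \<in> ?L" by blast
  qed auto
  have "emeasure lborel (cball (0::'a) 1 - {0}) = emeasure lborel (cball (0::'a) 1)"
    by (intro emeasure_Diff_null_set) (auto simp: null_sets_def)
  then show ?thesis
    by (subst emeasure_sphere_area) (simp_all only: eq, auto)
qed

lemma prob_space_uniform_sphere: "prob_space (uniform_sphere :: 'a::euclidean_space measure)"
  unfolding uniform_sphere_def
proof (rule prob_space_uniform_measure)
  have "0 < measure lebesgue (cball (0::'a) 1)" by (simp add: content_cball_pos)
  then have "emeasure lborel (cball (0::'a) 1) \<noteq> 0"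
    by (auto simp: measure_def)
  then show "emeasure (sphere_area :: 'a measure) (sphere 0 1) \<noteq> 0"
    by (simp add: emeasure_sphere_area_sphere)
  show "emeasure (sphere_area :: 'a measure) (sphere 0 1) \<noteq> \<infinity>"
    using emeasure_lborel_cball_finite[of "0::'a" 1]
    by (simp add: emeasure_sphere_area_sphere ennreal_mult_eq_top_iff)
qed

definition hermitian_inner :: "complex ^ 'n \<Rightarrow> complex ^ 'n \<Rightarrow> complex" where
  "hermitian_inner x y = (\<Sum>i\<in>UNIV. x $ i * cnj (y $ i))"

definition conj_transpose :: "complex ^ 'n ^ 'm \<Rightarrow> complex ^ 'm ^ 'n" where
  "conj_transpose A = (\<chi> i j. cnj (A $ j $ i))"

definition orthogonal_group :: "(real ^ 'n ^ 'n) set" where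
  "orthogonal_group = {Q. orthogonal_matrix Q}"

definition unitary_group :: "(complex ^ 'n ^ 'n) set" where
  "unitary_group = {U. conj_transpose U ** U = mat 1 \<and> U ** conj_transpose U = mat 1}"

definition real_orthonormal_basis :: "nat \<Rightarrow> (nat \<Rightarrow> real ^ 'n) \<Rightarrow> bool" where
  "real_orthonormal_basis d b \<longleftrightarrow>
     (\<forall>i\<in>{1..d}. \<forall>j\<in>{1..d}. b i \<bullet> b j = (if i = j then 1 else 0)) \<and>
     span (b ` {1..d}) = UNIV"

text \<open>Here \<^const>\<open>vec.span\<close> is the span with complex coefficients.\<close>

definition complex_orthonormal_basis :: "nat \<Rightarrow> (nat \<Rightarrow> complex ^ 'n) \<Rightarrow> bool" where
  "complex_orthonormal_basis d b \<longleftrightarrow>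
     (\<forall>i\<in>{1..d}. \<forall>j\<in>{1..d}. hermitian_inner (b i) (b j) = (if i = j then 1 else 0)) \<and>
     vec.span (b ` {1..d}) = UNIV"

text \<open>
  \<open>\<mu>\<close> is the normalized Haar measure of the compact matrix group \<open>G\<close>: a left-invariant Borel
  probability measure on \<open>G\<close>. Regularity is automatic, \<open>G\<close> being compact and metrizable.
\<close>

definition normalized_haar ::
    "('a::real_normed_field ^ 'n ^ 'n) set \<Rightarrow> ('a ^ 'n ^ 'n) measure \<Rightarrow> bool" where
  "normalized_haar G \<mu> \<longleftrightarrow>
     prob_space \<mu> \<and> sets \<mu> = sets (restrict_space borel G) \<and>
     (\<forall>g\<in>G. \<forall>A\<in>sets \<mu>. emeasure \<mu> ((\<lambda>h. g ** h) ` A) = emeasure \<mu> A)"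

end

theory Submission
  imports Defs
begin

text \<open>
  By Chebyshev it suffices that two entries \<open>R x\<close>, \<open>R y\<close> of the random frame satisfy
  \<open>Cov (\<phi> (R x)) (\<phi> (R y)) \<le> Var \<phi> / (d - 1)\<close>. This covariance is \<open>\<langle>\<phi>, T \<phi>\<rangle>\<close> for the self-adjoint
  operator \<open>T\<close> that averages a function over the unit vectors orthogonal to its argument, so one
  needs \<open>\<parallel>T\<parallel> \<le> \<kappa> = 1 / (d - 1)\<close> on mean zero functions.

  No spherical harmonics are needed. On functions of the form \<open>f (\<bar>\<langle>a, x\<rangle>\<bar>\<^sup>2)\<close> the operator acts as
  \<open>(S f) s = E (f ((1 - s) B))\<close> with \<open>B = \<bar>\<langle>v, Y\<rangle>\<bar>\<^sup>2\<close>, where \<open>Y\<close> is uniform on the unit sphere of a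
  hyperplane and \<open>v\<close> is a unit vector in it. As \<open>E B = \<kappa>\<close>, \<open>S\<close> contracts Lipschitz constants by the
  factor \<open>\<kappa>\<close>. Hence \<open>\<bar>T\<^sup>n \<psi>\<bar> \<le> C \<kappa>\<^sup>n\<close> for every mixture \<open>\<psi>\<close> of such functions with mean zero
  weights, where \<open>C\<close> may depend on \<open>\<psi>\<close>; and since \<open>n \<mapsto> \<parallel>T\<^sup>n \<psi>\<parallel>\<^sup>2\<close> is log-convex, this already forces
  \<open>\<parallel>T \<psi>\<parallel> \<le> \<kappa> \<parallel>\<psi>\<parallel>\<close>. These mixtures approximate all continuous phase invariant functions, in
  particular \<open>T \<phi>\<close> for continuous \<open>\<phi>\<close>; self-adjointness then gives
  \<open>\<parallel>T \<phi>\<parallel>\<^sup>2 = \<langle>\<phi>, T\<^sup>2 \<phi>\<rangle> \<le> \<kappa> \<parallel>\<phi>\<parallel> \<parallel>T \<phi>\<parallel>\<close>, and density of the continuous functions does the rest.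
\<close>

section \<open>Square integrable functions\<close>

definition square_integrable :: "'b measure \<Rightarrow> ('b \<Rightarrow> real) \<Rightarrow> bool" where
  "square_integrable M f \<longleftrightarrow> f \<in> borel_measurable M \<and> integrable M (\<lambda>x. (f x)\<^sup>2)"

lemma square_integrable_measurable [measurable_dest]:
  "square_integrable M f \<Longrightarrow> f \<in> borel_measurable M"
  by (simp add: square_integrable_def)

lemma square_integrable_integrable_power2:
  "square_integrable M f \<Longrightarrow> integrable M (\<lambda>x. (f x)\<^sup>2)"
  by (simp add: square_integrable_def)

lemma integrable_mult_square_integrable:
  assumes [measurable]: "square_integrable M f" "square_integrable M g"
  shows "integrable M (\<lambda>x. f x * g x)"
proof (rule Bochner_Integration.integrable_bound)
  show "integrable M (\<lambda>x. (f x)\<^sup>2 + (g x)\<^sup>2)"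
    using assms by (auto simp: square_integrable_def)
  have "\<bar>f x * g x\<bar> \<le> (f x)\<^sup>2 + (g x)\<^sup>2" for x
  proof -
    have "2 * \<bar>f x * g x\<bar> \<le> (f x)\<^sup>2 + (g x)\<^sup>2"
      using sum_squares_bound[of "\<bar>f x\<bar>" "\<bar>g x\<bar>"] by (simp add: abs_mult)
    then show ?thesis using abs_ge_zero[of "f x * g x"] by linarith
  qed
  then show "AE x in M. norm (f x * g x) \<le> norm ((f x)\<^sup>2 + (g x)\<^sup>2)"
    by simp
qed measurable

lemma square_integrable_cmult: "square_integrable M f \<Longrightarrow> square_integrable M (\<lambda>x. c * f x)"
  by (auto simp: square_integrable_def power_mult_distrib)

lemma square_integrable_add:
  assumes [measurable]: "square_integrable M f" "square_integrable M g"
  shows "square_integrable M (\<lambda>x. f x + g x)"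
proof -
  have "integrable M (\<lambda>x. (f x)\<^sup>2 + (g x)\<^sup>2 + 2 * (f x * g x))"
    using assms integrable_mult_square_integrable[OF assms] by (auto simp: square_integrable_def)
  moreover have "(\<lambda>x. f x + g x) \<in> borel_measurable M" by measurable
  ultimately show ?thesis
    by (simp add: square_integrable_def power2_sum mult.assoc)
qed

lemma square_integrable_sum:
  "(\<And>i. i \<in> I \<Longrightarrow> square_integrable M (f i)) \<Longrightarrow> square_integrable M (\<lambda>x. \<Sum>i\<in>I. f i x)"
  by (induction I rule: infinite_finite_induct)
     (auto intro: square_integrable_add simp: square_integrable_def[of _ "\<lambda>x. 0"])

lemma square_integrable_diff:
  "square_integrable M f \<Longrightarrow> square_integrable M g \<Longrightarrow> square_integrable M (\<lambda>x. f x - g x)"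
  using square_integrable_add[of M f "\<lambda>x. (- 1) * g x"] square_integrable_cmult[of M g "- 1"]
  by simp

lemma square_integrable_bound:
  assumes "square_integrable M g" and [measurable]: "f \<in> borel_measurable M"
    and abs_le: "\<And>x. \<bar>f x\<bar> \<le> \<bar>g x\<bar>"
  shows "square_integrable M f"
proof -
  have "integrable M (\<lambda>x. (f x)\<^sup>2)"
    by (rule Bochner_Integration.integrable_bound[of M "\<lambda>x. (g x)\<^sup>2"])
       (use assms(1) abs_le in \<open>auto simp: square_integrable_def abs_le_square_iff\<close>)
  then show ?thesis by (simp add: square_integrable_def)
qed

lemma (in finite_measure) square_integrable_const_bound:
  assumes "f \<in> borel_measurable M" "AE x in M. \<bar>f x\<bar> \<le> C"
  shows "square_integrable M f"
proof -
  have "AE x in M. norm ((f x)\<^sup>2) \<le> C\<^sup>2"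
    using assms(2)
  proof eventually_elim
    case (elim x)
    then have "\<bar>f x\<bar>\<^sup>2 \<le> C\<^sup>2" by (rule power_mono) simp
    then show ?case by simp
  qed
  then show ?thesis
    using assms(1) by (auto simp: square_integrable_def intro!: integrable_const_bound)
qed

lemma (in finite_measure) integrable_square_integrable:
  "square_integrable M f \<Longrightarrow> integrable M f"
  by (auto simp: square_integrable_def intro: square_integrable_imp_integrable)

lemma square_integrable_distr_iff:
  assumes [measurable]: "X \<in> M \<rightarrow>\<^sub>M N" "f \<in> borel_measurable N"
  shows "square_integrable (distr M N X) f \<longleftrightarrow> square_integrable M (\<lambda>x. f (X x))"
  by (simp add: square_integrable_def integrable_distr_eq)

lemma Cauchy_Schwarz_integral:
  fixes f g :: "'b \<Rightarrow> real"
  assumes square_integrable_f: "square_integrable M f"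
    and square_integrable_g: "square_integrable M g"
  shows "(\<integral>x. f x * g x \<partial>M)\<^sup>2 \<le> (\<integral>x. (f x)\<^sup>2 \<partial>M) * (\<integral>x. (g x)\<^sup>2 \<partial>M)"
proof -
  note [measurable] = square_integrable_f square_integrable_g
  define I where "I = (\<integral>x. \<bar>f x * g x\<bar> \<partial>M)"
  have "ennreal (I\<^sup>2) = (\<integral>\<^sup>+x. ennreal \<bar>f x\<bar> * ennreal \<bar>g x\<bar> \<partial>M)\<^sup>2"
    using integrable_mult_square_integrable[OF square_integrable_f square_integrable_g]
    by (simp add: I_def nn_integral_eq_integral ennreal_power flip: ennreal_mult abs_mult)
  also have "\<dots> \<le> (\<integral>\<^sup>+x. (ennreal \<bar>f x\<bar>)\<^sup>2 \<partial>M) * (\<integral>\<^sup>+x. (ennreal \<bar>g x\<bar>)\<^sup>2 \<partial>M)"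
    by (rule Cauchy_Schwarz_nn_integral) measurable
  also have "\<dots> = ennreal ((\<integral>x. (f x)\<^sup>2 \<partial>M) * (\<integral>x. (g x)\<^sup>2 \<partial>M))"
    using square_integrable_f square_integrable_g
    by (simp add: ennreal_power nn_integral_eq_integral ennreal_mult
        square_integrable_def)
  finally have "I\<^sup>2 \<le> (\<integral>x. (f x)\<^sup>2 \<partial>M) * (\<integral>x. (g x)\<^sup>2 \<partial>M)"
    by (simp add: ennreal_le_iff)
  moreover have "\<bar>\<integral>x. f x * g x \<partial>M\<bar>\<^sup>2 \<le> I\<^sup>2"
    unfolding I_def by (intro power_mono integral_abs_bound) simp
  ultimately show ?thesis by simp
qed

lemma integral_power2_add_le:
  assumes "square_integrable M f" "square_integrable M g"
  shows "(\<integral>x. (f x + g x)\<^sup>2 \<partial>M) \<le> 2 * (\<integral>x. (f x)\<^sup>2 \<partial>M) + 2 * (\<integral>x. (g x)\<^sup>2 \<partial>M)"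
proof -
  have "(\<integral>x. (f x + g x)\<^sup>2 \<partial>M) \<le> (\<integral>x. 2 * (f x)\<^sup>2 + 2 * (g x)\<^sup>2 \<partial>M)"
  proof (rule integral_mono)
    show "(f x + g x)\<^sup>2 \<le> 2 * (f x)\<^sup>2 + 2 * (g x)\<^sup>2" for x
      using sum_squares_bound[of "f x" "g x"] by (simp add: power2_sum)
  qed (use assms square_integrable_add[OF assms] in \<open>auto simp: square_integrable_def\<close>)
  then show ?thesis
    using assms by (simp add: square_integrable_def)
qed

lemma (in prob_space) prob_abs_le_ge_if_second_moment_le:
  assumes square_integrable_Z: "square_integrable M Z"
    and second_moment_le: "expectation (\<lambda>x. (Z x)\<^sup>2) \<le> \<epsilon> * c\<^sup>2"
    and c_nonneg: "0 \<le> c" and eps_nonneg: "0 \<le> \<epsilon>"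
  shows "1 - \<epsilon> \<le> prob {x \<in> space M. \<bar>Z x\<bar> \<le> c}"
proof (cases "c = 0")
  case True
  then have "expectation (\<lambda>x. (Z x)\<^sup>2) = 0"
    using second_moment_le by (intro antisym) simp_all
  then have "AE x in M. (Z x)\<^sup>2 = 0"
    using square_integrable_Z
    by (subst (asm) integral_nonneg_eq_0_iff_AE)
       (auto simp: square_integrable_def)
  then have "AE x in M. \<bar>Z x\<bar> \<le> c" by eventually_elim (simp add: c_nonneg)
  then have "prob {x \<in> space M. \<bar>Z x\<bar> \<le> c} = 1"
    using square_integrable_Z by (subst prob_Collect_eq_1) auto
  then show ?thesis using eps_nonneg by simp
next
  case False
  then have c_pos: "0 < c" using c_nonneg by simp
  have [measurable]: "Z \<in> borel_measurable M" using square_integrable_Z by measurable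
  have "1 - prob {x \<in> space M. \<bar>Z x\<bar> \<le> c} = prob {x \<in> space M. \<not> \<bar>Z x\<bar> \<le> c}"
    by (rule prob_neg[symmetric]) measurable
  also have "\<dots> \<le> prob {x \<in> space M. c \<le> \<bar>Z x\<bar>}"
    by (intro finite_measure_mono) auto
  also have "\<dots> \<le> expectation (\<lambda>x. (Z x)\<^sup>2) / c\<^sup>2"
    by (rule second_moment_method)
       (use square_integrable_Z c_pos in \<open>auto simp: square_integrable_def\<close>)
  also have "\<dots> \<le> \<epsilon>" using second_moment_le c_pos by (simp add: field_simps)
  finally show ?thesis by simp
qed

lemma tendsto_integral_mult_0:
  assumes "\<And>n. square_integrable M (u n)" "\<And>n. square_integrable M (v n)"
    and mult_0: "(\<lambda>n. (\<integral>x. (u n x)\<^sup>2 \<partial>M) * (\<integral>x. (v n x)\<^sup>2 \<partial>M)) \<longlonglongrightarrow> 0"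
  shows "(\<lambda>n. \<integral>x. u n x * v n x \<partial>M) \<longlonglongrightarrow> 0"
proof -
  have "(\<lambda>n. (\<integral>x. u n x * v n x \<partial>M)\<^sup>2) \<longlonglongrightarrow> 0"
    by (rule tendsto_sandwich[OF _ _ tendsto_const mult_0])
       (auto intro!: always_eventually Cauchy_Schwarz_integral assms)
  then show ?thesis by simp
qed

definition L2_tendsto :: "'b measure \<Rightarrow> (nat \<Rightarrow> 'b \<Rightarrow> real) \<Rightarrow> ('b \<Rightarrow> real) \<Rightarrow> bool" where
  "L2_tendsto M F f \<longleftrightarrow> (\<forall>n. square_integrable M (F n)) \<and> square_integrable M f \<and>
     (\<lambda>n. \<integral>x. (F n x - f x)\<^sup>2 \<partial>M) \<longlonglongrightarrow> 0"

lemma L2_tendsto_integral_mult: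
  assumes F_tendsto: "L2_tendsto M F f" and G_tendsto: "L2_tendsto M G g"
  shows "(\<lambda>n. \<integral>x. F n x * G n x \<partial>M) \<longlonglongrightarrow> (\<integral>x. f x * g x \<partial>M)"
proof -
  have square_integrable: "square_integrable M (F n)" "square_integrable M (G n)"
      "square_integrable M f" "square_integrable M g" for n
    using F_tendsto G_tendsto by (auto simp: L2_tendsto_def)
  have errors_tendsto_0: "(\<lambda>n. \<integral>x. (F n x - f x)\<^sup>2 \<partial>M) \<longlonglongrightarrow> 0" "(\<lambda>n. \<integral>x. (G n x - g x)\<^sup>2 \<partial>M) \<longlonglongrightarrow> 0"
    using F_tendsto G_tendsto by (auto simp: L2_tendsto_def)
  have "(\<lambda>n. (\<integral>x. f x * g x \<partial>M) + (\<integral>x. (F n x - f x) * (G n x - g x) \<partial>M)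
      + (\<integral>x. (F n x - f x) * g x \<partial>M) + (\<integral>x. f x * (G n x - g x) \<partial>M))
    \<longlonglongrightarrow> (\<integral>x. f x * g x \<partial>M) + 0 + 0 + 0"
    by (intro tendsto_intros tendsto_integral_mult_0 square_integrable_diff square_integrable
        tendsto_mult_zero[OF errors_tendsto_0]
        tendsto_mult_left_zero[OF errors_tendsto_0(1)]
            tendsto_mult_right_zero[OF errors_tendsto_0(2)])
  moreover have "(\<integral>x. F n x * G n x \<partial>M)
      = (\<integral>x. f x * g x \<partial>M) + (\<integral>x. (F n x - f x) * (G n x - g x) \<partial>M)
      + (\<integral>x. (F n x - f x) * g x \<partial>M) + (\<integral>x. f x * (G n x - g x) \<partial>M)" for n
  proof -
    have "(\<integral>x. F n x * G n x \<partial>M) = (\<integral>x. f x * g x + (F n x - f x) * (G n x - g x)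
        + (F n x - f x) * g x + f x * (G n x - g x) \<partial>M)"
      by (rule Bochner_Integration.integral_cong) (simp_all add: algebra_simps)
    also have "\<dots> = (\<integral>x. f x * g x \<partial>M) + (\<integral>x. (F n x - f x) * (G n x - g x) \<partial>M)
        + (\<integral>x. (F n x - f x) * g x \<partial>M) + (\<integral>x. f x * (G n x - g x) \<partial>M)"
      using square_integrable
      by (simp add: integrable_mult_square_integrable square_integrable_diff)
    finally show ?thesis .
  qed
  ultimately show ?thesis by simp
qed

lemma L2_tendsto_integral_power2:
  "L2_tendsto M F f \<Longrightarrow> (\<lambda>n. \<integral>x. (F n x)\<^sup>2 \<partial>M) \<longlonglongrightarrow> (\<integral>x. (f x)\<^sup>2 \<partial>M)"
  unfolding power2_eq_square by (rule L2_tendsto_integral_mult)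

lemma L2_tendsto_distr:
  assumes [measurable]: "X \<in> M \<rightarrow>\<^sub>M N" and F_tendsto: "L2_tendsto (distr M N X) F f"
  shows "L2_tendsto M (\<lambda>n x. F n (X x)) (\<lambda>x. f (X x))"
proof -
  have [measurable]: "F n \<in> borel_measurable N" "f \<in> borel_measurable N" for n
    using F_tendsto by (auto simp: L2_tendsto_def square_integrable_def)
  show ?thesis
    using F_tendsto by (simp add: L2_tendsto_def square_integrable_distr_iff integral_distr)
qed

lemma L2_tendsto_incseq:
  assumes square_integrable_f: "square_integrable M f"
    and [measurable]: "\<And>i. U i \<in> borel_measurable M"
    and nonneg: "\<And>i x. 0 \<le> U i x" and U_le_f: "\<And>i x. U i x \<le> f x"
    and U_tendsto: "\<And>x. x \<in> space M \<Longrightarrow> (\<lambda>i. U i x) \<longlonglongrightarrow> f x"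
  shows "L2_tendsto M U f"
proof -
  note [measurable] = square_integrable_f
  have "(\<lambda>i. \<integral>x. (U i x - f x)\<^sup>2 \<partial>M) \<longlonglongrightarrow> (\<integral>x. 0 \<partial>M)"
  proof (rule integral_dominated_convergence[where w = "\<lambda>x. (f x)\<^sup>2"])
    show "AE x in M. (\<lambda>i. (U i x - f x)\<^sup>2) \<longlonglongrightarrow> 0"
    proof (rule AE_I2)
      fix x assume "x \<in> space M"
      then have "(\<lambda>i. (U i x - f x)\<^sup>2) \<longlonglongrightarrow> (f x - f x)\<^sup>2" by (intro tendsto_intros U_tendsto)
      then show "(\<lambda>i. (U i x - f x)\<^sup>2) \<longlonglongrightarrow> 0" by simp
    qed
    have "(U i x - f x)\<^sup>2 \<le> (f x)\<^sup>2" for i x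
      using nonneg[of i x] U_le_f[of i x] by (intro abs_le_square_iff[THEN iffD1]) linarith
    then show "AE x in M. norm ((U i x - f x)\<^sup>2) \<le> (f x)\<^sup>2" for i by simp
  qed (use square_integrable_f in \<open>auto simp: square_integrable_def\<close>)
  moreover have "square_integrable M (U i)" for i
  proof (rule square_integrable_bound[OF square_integrable_f])
    show "\<bar>U i x\<bar> \<le> \<bar>f x\<bar>" for x using nonneg[of i x] U_le_f[of i x] by linarith
  qed simp
  ultimately show ?thesis using square_integrable_f by (simp add: L2_tendsto_def)
qed

lemma (in prob_space) abs_expectation_le:
  fixes f :: "'a \<Rightarrow> real"
  assumes "integrable M f" "AE x in M. \<bar>f x\<bar> \<le> C"
  shows "\<bar>expectation f\<bar> \<le> C"
  using assms by (intro order_trans[OF integral_abs_bound integral_le_const]) simp_all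

lemma (in prob_space) L2_tendsto_if_uniform:
  assumes square_integrable: "\<And>n. square_integrable M (F n)" "square_integrable M f"
    and uniform: "\<And>n. AE x in M. \<bar>F n x - f x\<bar> \<le> e n" and e_tendsto_0: "e \<longlonglongrightarrow> 0"
  shows "L2_tendsto M F f"
proof -
  have error_le: "(\<integral>x. (F n x - f x)\<^sup>2 \<partial>M) \<le> (e n)\<^sup>2" for n
  proof (rule integral_le_const)
    show "integrable M (\<lambda>x. (F n x - f x)\<^sup>2)"
      using square_integrable_diff[OF square_integrable] by (simp add: square_integrable_def)
    show "AE x in M. (F n x - f x)\<^sup>2 \<le> (e n)\<^sup>2"
      using uniform[of n] by eventually_elim (metis abs_ge_zero power2_abs power_mono)
  qed
  have e_power2_tendsto_0: "(\<lambda>n. (e n)\<^sup>2) \<longlonglongrightarrow> 0" using tendsto_power[OF e_tendsto_0, of 2] by simp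
  have "(\<lambda>n. \<integral>x. (F n x - f x)\<^sup>2 \<partial>M) \<longlonglongrightarrow> 0"
    by (rule tendsto_sandwich[OF _ _ tendsto_const e_power2_tendsto_0])
       (auto intro!: always_eventually error_le)
  then show ?thesis using square_integrable by (simp add: L2_tendsto_def)
qed

lemma (in prob_space) L2_tendsto_centered:
  assumes F_tendsto: "L2_tendsto M F f" and mean_zero: "expectation f = 0"
  shows "L2_tendsto M (\<lambda>n x. F n x - expectation (F n)) f"
proof -
  have square_integrable: "square_integrable M (F n)" "square_integrable M f" for n
    using F_tendsto by (auto simp: L2_tendsto_def)
  have centered_error_le: "(\<integral>x. (F n x - expectation (F n) - f x)\<^sup>2 \<partial>M)
      \<le> (\<integral>x. (F n x - f x)\<^sup>2 \<partial>M)" for n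
  proof -
    have square_integrable_diff_f: "square_integrable M (\<lambda>x. F n x - f x)"
      by (intro square_integrable_diff square_integrable)
    have "expectation (\<lambda>x. F n x - f x) = expectation (F n)"
      using square_integrable by (simp add: mean_zero integrable_square_integrable)
    then have "(\<integral>x. (F n x - expectation (F n) - f x)\<^sup>2 \<partial>M) = variance (\<lambda>x. F n x - f x)"
      by (simp add: diff_diff_eq add.commute)
    also have "\<dots> \<le> (\<integral>x. (F n x - f x)\<^sup>2 \<partial>M)"
      using square_integrable_diff_f
      by (subst variance_eq)
         (auto simp: integrable_square_integrable square_integrable_def)
    finally show ?thesis .
  qed
  have error_tendsto_0: "(\<lambda>n. \<integral>x. (F n x - f x)\<^sup>2 \<partial>M) \<longlonglongrightarrow> 0"
    using F_tendsto by (simp add: L2_tendsto_def)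
  have "(\<lambda>n. \<integral>x. (F n x - expectation (F n) - f x)\<^sup>2 \<partial>M) \<longlonglongrightarrow> 0"
    by (rule tendsto_sandwich[OF _ _ tendsto_const error_tendsto_0])
       (auto intro!: always_eventually centered_error_le)
  moreover have "square_integrable M (\<lambda>x. F n x - expectation (F n))" for n
    by (intro square_integrable_diff square_integrable square_integrable_const_bound) auto
  ultimately show ?thesis using square_integrable by (simp add: L2_tendsto_def)
qed

section \<open>Density of the continuous functions\<close>

definition bounded_borel :: "('b::topological_space \<Rightarrow> real) \<Rightarrow> bool" where
  "bounded_borel f \<longleftrightarrow> f \<in> borel_measurable borel \<and> (\<exists>C. \<forall>x. \<bar>f x\<bar> \<le> C)"

lemma bounded_borelI: "f \<in> borel_measurable borel \<Longrightarrow> (\<And>x. \<bar>f x\<bar> \<le> C) \<Longrightarrow> bounded_borel f"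
  by (auto simp: bounded_borel_def)

lemma bounded_borelE:
  assumes "bounded_borel f"
  obtains C where "\<And>x. \<bar>f x\<bar> \<le> C" "0 \<le> C"
  using assms unfolding bounded_borel_def by (metis abs_ge_zero order_trans)

lemma bounded_borel_measurable [measurable_dest]: "bounded_borel f \<Longrightarrow> f \<in> borel_measurable borel"
  by (auto simp: bounded_borel_def)

lemma bounded_borel_const: "bounded_borel (\<lambda>x. c)"
  by (rule bounded_borelI[of _ "\<bar>c\<bar>"]) auto

lemma bounded_borel_mult:
  assumes [measurable]: "bounded_borel f" "bounded_borel g"
  shows "bounded_borel (\<lambda>x. f x * g x)"
proof -
  obtain C where f_le: "\<And>x. \<bar>f x\<bar> \<le> C" "0 \<le> C" using bounded_borelE[OF assms(1)] by blast
  obtain D where g_le: "\<And>x. \<bar>g x\<bar> \<le> D" using bounded_borelE[OF assms(2)] by blast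
  show ?thesis
    by (rule bounded_borelI[of _ "C * D"]) (auto simp: abs_mult intro!: mult_mono f_le g_le)
qed

lemma bounded_borel_add:
  assumes [measurable]: "bounded_borel f" "bounded_borel g"
  shows "bounded_borel (\<lambda>x. f x + g x)"
proof -
  obtain C where f_le: "\<And>x. \<bar>f x\<bar> \<le> C" using bounded_borelE[OF assms(1)] by blast
  obtain D where g_le: "\<And>x. \<bar>g x\<bar> \<le> D" using bounded_borelE[OF assms(2)] by blast
  have "\<bar>f x + g x\<bar> \<le> C + D" for x using f_le[of x] g_le[of x] by linarith
  then show ?thesis by (intro bounded_borelI[of _ "C + D"]) auto
qed

lemma bounded_borel_diff:
  "bounded_borel f \<Longrightarrow> bounded_borel g \<Longrightarrow> bounded_borel (\<lambda>x. f x - g x)"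
  using bounded_borel_add[of f "\<lambda>x. (- 1) * g x"]
      bounded_borel_mult[OF bounded_borel_const, of g "- 1"]
  by simp

lemma bounded_borel_abs: "bounded_borel f \<Longrightarrow> bounded_borel (\<lambda>x. \<bar>f x\<bar>)"
  by (auto simp: bounded_borel_def)

lemma bounded_borel_compose:
  assumes "bounded_borel f" and [measurable]: "g \<in> borel_measurable borel"
  shows "bounded_borel (\<lambda>x. f (g x))"
  using assms(1) by (auto simp: bounded_borel_def)

lemmas bounded_borel_intros = bounded_borel_const bounded_borel_mult bounded_borel_add
  bounded_borel_diff bounded_borel_abs

locale finite_euclidean_measure = finite_measure M
  for M :: "'b::euclidean_space measure" +
  assumes sets_eq_borel [measurable_cong]: "sets M = sets borel"
begin

lemma square_integrable_bounded_borel: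
  assumes [measurable]: "bounded_borel f"
  shows "square_integrable M f"
proof -
  obtain C where "\<And>x. \<bar>f x\<bar> \<le> C" using bounded_borelE[OF assms] by blast
  then show ?thesis
    by (intro square_integrable_const_bound[of _ C]) auto
qed

lemma square_integrable_borel: "square_integrable M f \<Longrightarrow> f \<in> borel_measurable borel"
  by (simp add: square_integrable_def measurable_cong_sets[OF sets_eq_borel refl])

lemma integrable_bounded_borel: "bounded_borel f \<Longrightarrow> integrable M f"
  by (intro integrable_square_integrable square_integrable_bounded_borel)

end

definition L2_approximable :: "'b::topological_space measure \<Rightarrow> ('b \<Rightarrow> real) \<Rightarrow> bool" where
  "L2_approximable M f \<longleftrightarrow>
     (\<forall>e>0. \<exists>g. continuous_on UNIV g \<and> bounded_borel g \<and> (\<integral>x. (f x - g x)\<^sup>2 \<partial>M) < e)"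

lemma L2_approximableE:
  assumes "L2_approximable M f" "0 < e"
  obtains g where "continuous_on UNIV g" "bounded_borel g" "(\<integral>x. (f x - g x)\<^sup>2 \<partial>M) < e"
  using assms unfolding L2_approximable_def by blast

lemma Lebesgue_approximation_compact_open:
  fixes M :: "'b::{second_countable_topology, complete_space} measure"
  assumes "finite_measure M" and sets: "sets M = sets borel" and borel_A: "A \<in> sets borel"
    and e_pos: "0 < e"
  obtains K V where "compact K" "open V" "K \<subseteq> A" "A \<subseteq> V" "measure M (V - K) < e"
proof -
  interpret finite_measure M by fact
  have finite_A: "emeasure M A \<noteq> \<infinity>" "emeasure M (space M) \<noteq> \<infinity>"
    by (simp_all add: emeasure_eq_measure)
  have half_e_pos: "0 < e / 2" using e_pos by simp
  have "{K. K \<subseteq> A \<and> compact K} \<noteq> {}" using compact_empty by blast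
  then obtain K where compact_K: "K \<subseteq> A" "compact K" "emeasure M A < emeasure M K + e / 2"
    using SUP_approx_ennreal[OF half_e_pos _ inner_regular[OF sets finite_A(2) borel_A]
        finite_A(1)] by auto
  obtain V where open_V: "A \<subseteq> V" "open V" "emeasure M V < emeasure M A + e / 2"
    using INF_approx_ennreal[OF half_e_pos outer_regular[OF sets finite_A(2) borel_A]
        finite_A(1)] by auto
  have "measure M A < measure M K + e / 2" "measure M V < measure M A + e / 2"
    using compact_K(3) open_V(3) e_pos
    by (simp_all add: emeasure_eq_measure ennreal_less_iff flip: ennreal_plus)
  moreover have "measure M (V - K) = measure M V - measure M K"
    using compact_K open_V
    by (intro finite_measure_Diff)
       (auto simp: sets intro: borel_closed compact_imp_closed)
  ultimately show ?thesis using that[of K V] compact_K open_V by simp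
qed

lemma L2_approximable_cmult:
  assumes "L2_approximable M f" shows "L2_approximable M (\<lambda>x. c * f x)"
  unfolding L2_approximable_def
proof (intro allI impI)
  fix e :: real assume e_pos: "0 < e"
  have factor_pos: "0 < c\<^sup>2 + 1" by (rule add_nonneg_pos) simp_all
  obtain g where approx_g: "continuous_on UNIV g" "bounded_borel g"
      "(\<integral>x. (f x - g x)\<^sup>2 \<partial>M) < e / (c\<^sup>2 + 1)"
    using L2_approximableE[OF assms, of "e / (c\<^sup>2 + 1)"] e_pos factor_pos by auto
  have "(\<integral>x. (c * f x - c * g x)\<^sup>2 \<partial>M) = c\<^sup>2 * (\<integral>x. (f x - g x)\<^sup>2 \<partial>M)"
    by (simp add: power_mult_distrib flip: right_diff_distrib)
  also have "\<dots> \<le> (c\<^sup>2 + 1) * (\<integral>x. (f x - g x)\<^sup>2 \<partial>M)"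
    by (intro mult_right_mono) simp_all
  also have "\<dots> < e" using approx_g(3) factor_pos by (simp add: field_simps)
  finally show "\<exists>g. continuous_on UNIV g \<and> bounded_borel g \<and> (\<integral>x. (c * f x - g x)\<^sup>2 \<partial>M) < e"
    using approx_g
    by (intro exI[of _ "\<lambda>x. c * g x"])
       (auto intro!: continuous_intros bounded_borel_intros)
qed

context finite_euclidean_measure
begin

lemma L2_approximable_indicator:
  assumes borel_A: "A \<in> sets borel"
  shows "L2_approximable M (indicator A)"
  unfolding L2_approximable_def
proof (intro allI impI)
  fix e :: real assume "0 < e"
  then obtain K V where compact_K: "compact K" "K \<subseteq> A" and open_V: "open V" "A \<subseteq> V"
      and small: "measure M (V - K) < e"
    using Lebesgue_approximation_compact_open[OF finite_measure_axioms sets_eq_borel borel_A]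
    by metis
  have "K \<inter> - V = {}" using compact_K open_V by auto
  then obtain g :: "'b \<Rightarrow> real" where continuous_g: "continuous_on UNIV g"
      "\<And>x. g x \<in> closed_segment 1 0"
      "\<And>x. x \<in> K \<Longrightarrow> g x = 1" "\<And>x. x \<in> - V \<Longrightarrow> g x = 0"
    using Urysohn[of K "- V" 1 0] compact_K open_V compact_imp_closed by (metis closed_Compl)
  have g_range: "0 \<le> g x" "g x \<le> 1" for x
    using continuous_g(2)[of x] by (auto simp: closed_segment_eq_real_ivl)
  have bounded: "bounded_borel g"
    by (rule bounded_borelI[of _ 1])
       (use g_range continuous_g(1) in \<open>auto intro: borel_measurable_continuous_onI\<close>)
  have sets_V_diff_K: "V - K \<in> sets M"
    using compact_K open_V by (auto simp: sets_eq_borel compact_imp_closed intro!: sets.Diff)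
  have "(\<integral>x. (indicator A x - g x)\<^sup>2 \<partial>M) \<le> (\<integral>x. indicator (V - K) x \<partial>M)"
  proof (rule integral_mono)
    have "bounded_borel (\<lambda>x. indicator A x - g x)"
      using borel_A bounded by (intro bounded_borel_diff bounded_borelI[of "indicator A" 1]) auto
    then show "integrable M (\<lambda>x. (indicator A x - g x)\<^sup>2)"
      by (intro square_integrable_integrable_power2 square_integrable_bounded_borel)
    show "integrable M (indicator (V - K) :: 'b \<Rightarrow> real)"
      using sets_V_diff_K by (simp add: emeasure_eq_measure)
    show "(indicator A x - g x)\<^sup>2 \<le> indicator (V - K) x" for x
    proof -
      have "\<bar>indicator A x - g x\<bar> \<le> 1" using g_range[of x] by (auto simp: indicator_def)
      then have "(indicator A x - g x)\<^sup>2 \<le> 1" by (simp add: abs_square_le_1)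
      then show ?thesis using continuous_g(3,4)[of x] compact_K(2) open_V(2)
        by (auto simp: indicator_def)
    qed
  qed
  also have "\<dots> < e" using sets_V_diff_K small by (simp add: sets_eq_imp_space_eq[OF sets_eq_borel])
  finally show "\<exists>g. continuous_on UNIV g \<and> bounded_borel g \<and> (\<integral>x. (indicator A x - g x)\<^sup>2 \<partial>M) < e"
    using continuous_g(1) bounded by blast
qed

lemma L2_approximable_add:
  assumes approximable_f1: "L2_approximable M f1" "square_integrable M f1"
    and approximable_f2: "L2_approximable M f2" "square_integrable M f2"
  shows "L2_approximable M (\<lambda>x. f1 x + f2 x)"
  unfolding L2_approximable_def
proof (intro allI impI)
  fix e :: real assume "0 < e"
  then have quarter_e_pos: "0 < e / 4" by simp
  obtain g1 where approx_g1: "continuous_on UNIV g1" "bounded_borel g1"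
      "(\<integral>x. (f1 x - g1 x)\<^sup>2 \<partial>M) < e / 4"
    using L2_approximableE[OF approximable_f1(1) quarter_e_pos] .
  obtain g2 where approx_g2: "continuous_on UNIV g2" "bounded_borel g2"
      "(\<integral>x. (f2 x - g2 x)\<^sup>2 \<partial>M) < e / 4"
    using L2_approximableE[OF approximable_f2(1) quarter_e_pos] .
  have "(\<integral>x. ((f1 x - g1 x) + (f2 x - g2 x))\<^sup>2 \<partial>M)
      \<le> 2 * (\<integral>x. (f1 x - g1 x)\<^sup>2 \<partial>M) + 2 * (\<integral>x. (f2 x - g2 x)\<^sup>2 \<partial>M)"
    by (intro integral_power2_add_le square_integrable_diff approximable_f1 approximable_f2
        square_integrable_bounded_borel approx_g1 approx_g2)
  also have "\<dots> < e" using approx_g1(3) approx_g2(3) by simp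
  finally have "(\<integral>x. (f1 x + f2 x - (g1 x + g2 x))\<^sup>2 \<partial>M) < e" by (simp add: algebra_simps)
  then show "\<exists>g. continuous_on UNIV g \<and> bounded_borel g \<and> (\<integral>x. (f1 x + f2 x - g x)\<^sup>2 \<partial>M) < e"
    using approx_g1 approx_g2
    by (intro exI[of _ "\<lambda>x. g1 x + g2 x"])
       (auto intro!: continuous_intros bounded_borel_intros)
qed

lemma L2_approximable_lim:
  assumes F_tendsto: "L2_tendsto M F f" and approximable_F: "\<And>n. L2_approximable M (F n)"
  shows "L2_approximable M f"
  unfolding L2_approximable_def
proof (intro allI impI)
  fix e :: real assume "0 < e"
  then have quarter_e_pos: "0 < e / 4" by simp
  have square_integrable: "square_integrable M (F n)" "square_integrable M f" for n
    using F_tendsto by (auto simp: L2_tendsto_def)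
  have "\<forall>\<^sub>F n in sequentially. (\<integral>x. (F n x - f x)\<^sup>2 \<partial>M) < e / 4"
    using F_tendsto quarter_e_pos by (intro order_tendstoD) (auto simp: L2_tendsto_def)
  then obtain n where F_near_f: "(\<integral>x. (F n x - f x)\<^sup>2 \<partial>M) < e / 4"
    by (auto simp: eventually_sequentially)
  obtain g where approx_g: "continuous_on UNIV g" "bounded_borel g"
      "(\<integral>x. (F n x - g x)\<^sup>2 \<partial>M) < e / 4"
    using L2_approximableE[OF approximable_F quarter_e_pos] .
  have "(\<integral>x. ((f x - F n x) + (F n x - g x))\<^sup>2 \<partial>M)
      \<le> 2 * (\<integral>x. (f x - F n x)\<^sup>2 \<partial>M) + 2 * (\<integral>x. (F n x - g x)\<^sup>2 \<partial>M)"
    by (intro integral_power2_add_le square_integrable_diff square_integrable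
        square_integrable_bounded_borel approx_g)
  also have "\<dots> < e" using F_near_f approx_g(3) by (simp add: power2_commute)
  finally have "(\<integral>x. (f x - g x)\<^sup>2 \<partial>M) < e" by simp
  then show "\<exists>g. continuous_on UNIV g \<and> bounded_borel g \<and> (\<integral>x. (f x - g x)\<^sup>2 \<partial>M) < e"
    using approx_g by blast
qed

lemma L2_approximable_nonneg:
  assumes square_integrable_f: "square_integrable M f" and nonneg: "\<And>x. 0 \<le> f x"
  shows "L2_approximable M f"
proof -
  have "f \<in> borel_measurable M" using square_integrable_f by measurable
  then show ?thesis using nonneg square_integrable_f
  proof (induction f rule: borel_measurable_induct_real)
    case (set A)
    then show ?case using L2_approximable_indicator by (simp add: sets_eq_borel)
  next
    case (mult u c)
    show ?case
    proof (cases "c = 0")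
      case True
      then show ?thesis
        by (auto simp: L2_approximable_def intro!: exI[of _ "\<lambda>_. 0"] bounded_borel_const)
    next
      case False
      then have "square_integrable M u"
        using square_integrable_cmult[OF mult.prems, of "1 / c"] by simp
      then show ?thesis by (intro L2_approximable_cmult mult.IH)
    qed
  next
    case (add u v)
    have "square_integrable M u" "square_integrable M v"
      using add.hyps by (auto intro!: square_integrable_bound[OF add.prems])
    then show ?case by (intro L2_approximable_add add.IH)
  next
    case (seq U)
    have space: "space M = UNIV" using sets_eq_imp_space_eq[OF sets_eq_borel] by simp
    have U_le_f: "U i x \<le> f x" for i x
      using seq.hyps by (intro incseq_le) (auto simp: space incseq_def le_fun_def)
    have U_tendsto: "L2_tendsto M U f"
      using seq.hyps by (intro L2_tendsto_incseq seq.prems U_le_f) auto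
    show ?case
      by (rule L2_approximable_lim[OF U_tendsto])
         (use U_tendsto in \<open>auto simp: L2_tendsto_def intro: seq.IH\<close>)
  qed
qed

theorem L2_tendsto_continuous:
  assumes square_integrable_f: "square_integrable M f"
  obtains g where "L2_tendsto M g f" "\<And>n. continuous_on UNIV (g n)" "\<And>n. bounded_borel (g n)"
proof -
  note [measurable] = square_integrable_f
  have square_integrable_parts: "square_integrable M (\<lambda>x. max 0 (f x))"
      "square_integrable M (\<lambda>x. max 0 (- f x))"
    by (auto intro!: square_integrable_bound[OF square_integrable_f])
  have "L2_approximable M (\<lambda>x. max 0 (f x) + (- 1) * max 0 (- f x))"
    by (intro L2_approximable_add L2_approximable_cmult L2_approximable_nonneg
        square_integrable_cmult square_integrable_parts) simp_all
  moreover have "max 0 (f x) + (- 1) * max 0 (- f x) = f x" for x by (simp add: max_def)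
  ultimately have "L2_approximable M f" by simp
  then have "\<forall>n. \<exists>g. continuous_on UNIV g \<and> bounded_borel g
      \<and> (\<integral>x. (f x - g x)\<^sup>2 \<partial>M) < inverse (Suc n)"
    by (simp add: L2_approximable_def)
  then obtain g where approx_g: "\<And>n. continuous_on UNIV (g n)" "\<And>n. bounded_borel (g n)"
      "\<And>n. (\<integral>x. (f x - g n x)\<^sup>2 \<partial>M) < inverse (Suc n)"
    unfolding choice_iff by blast
  have "(\<lambda>n. \<integral>x. (g n x - f x)\<^sup>2 \<partial>M) \<longlonglongrightarrow> 0"
    by (rule tendsto_sandwich[OF _ _ tendsto_const LIMSEQ_inverse_real_of_nat])
       (use approx_g(3) in \<open>auto simp: power2_commute less_imp_le\<close>)
  then have "L2_tendsto M g f"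
    using square_integrable_f approx_g(2)
    by (simp add: L2_tendsto_def square_integrable_bounded_borel)
  then show ?thesis using that approx_g by blast
qed

end

section \<open>Rotation invariance of the uniform distribution on the sphere\<close>

lemma nn_integral_lborel_translation:
  fixes F :: "'b::euclidean_space \<Rightarrow> ennreal"
  assumes [measurable]: "F \<in> borel_measurable borel"
  shows "(\<integral>\<^sup>+y. F (c + y) \<partial>lborel) = (\<integral>\<^sup>+y. F y \<partial>lborel)"
  by (subst (2) lborel_distr_plus[of c, symmetric]) (simp add: nn_integral_distr)

text \<open>Both sides are \<open>(N \<times> lborel) {(x, y). x \<in> A \<and> y - x \<in> B}\<close>, integrated in either order.\<close>

lemma translation_invariant_mult_lborel:
  fixes N :: "'b::euclidean_space measure"
  assumes "sigma_finite_measure N" and [measurable_cong]: "sets N = sets borel"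
    and invariant: "\<And>F c. F \<in> borel_measurable borel \<Longrightarrow> (\<integral>\<^sup>+x. F (x + c) \<partial>N) = (\<integral>\<^sup>+x. F x \<partial>N)"
    and [measurable]: "A \<in> sets borel" "B \<in> sets borel"
  shows "emeasure N A * emeasure lborel B = emeasure lborel A * emeasure N (uminus ` B)"
proof -
  interpret N: sigma_finite_measure N by fact
  interpret P: pair_sigma_finite N lborel ..
  have indicator_uminus: "indicator B (- x) = (indicator (uminus ` B) x :: ennreal)" for x
    by (force simp: indicator_def)
  have "uminus -` B = uminus ` B" by force
  then have [measurable]: "uminus ` B \<in> sets borel"
    using measurable_sets_borel[of uminus borel B] by simp
  have emeasure_shifted_B: "(\<integral>\<^sup>+y. indicator B (y - x) \<partial>lborel) = emeasure lborel B" for x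
    using nn_integral_lborel_translation[of "indicator B" "- x"] by simp
  have "emeasure N A * emeasure lborel B = (\<integral>\<^sup>+x. indicator A x * emeasure lborel B \<partial>N)"
    by (simp add: nn_integral_multc)
  also have "\<dots> = (\<integral>\<^sup>+x. (\<integral>\<^sup>+y. indicator A x * indicator B (y - x) \<partial>lborel) \<partial>N)"
    by (simp add: nn_integral_cmult emeasure_shifted_B)
  also have "\<dots> = (\<integral>\<^sup>+y. (\<integral>\<^sup>+x. indicator A x * indicator B (y - x) \<partial>N) \<partial>lborel)"
    by (rule P.Fubini'[symmetric]) measurable
  also have "\<dots> = (\<integral>\<^sup>+y. (\<integral>\<^sup>+x. indicator A (x + y) * indicator B (y - (x + y)) \<partial>N) \<partial>lborel)"
    by (intro nn_integral_cong invariant[symmetric]) measurable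
  also have "\<dots> = (\<integral>\<^sup>+x. (\<integral>\<^sup>+y. indicator A (x + y) * indicator B (- x) \<partial>lborel) \<partial>N)"
    by (simp, rule P.Fubini') measurable
  also have "\<dots> = (\<integral>\<^sup>+x. emeasure lborel A * indicator (uminus ` B) x \<partial>N)"
    by (simp add: nn_integral_multc nn_integral_lborel_translation[of "indicator A"]
        indicator_uminus)
  also have "\<dots> = emeasure lborel A * emeasure N (uminus ` B)"
    by (simp add: nn_integral_cmult)
  finally show ?thesis .
qed

lemma sigma_finite_measure_if_ball_finite:
  fixes N :: "'b::real_normed_vector measure"
  assumes sets: "sets N = sets borel" and finite: "\<And>r. emeasure N (ball 0 r) \<noteq> \<infinity>"
  shows "sigma_finite_measure N"
proof
  show "\<exists>A. countable A \<and> A \<subseteq> sets N \<and> \<Union>A = space N \<and> (\<forall>a\<in>A. emeasure N a \<noteq> \<infinity>)"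
  proof (intro exI[of _ "range (\<lambda>n::nat. ball 0 (real n))"] conjI ballI)
    show "\<Union> (range (\<lambda>n::nat. ball (0::'b) (real n))) = space N"
      using reals_Archimedean2 by (auto simp: sets_eq_imp_space_eq[OF sets])
  qed (use finite in \<open>auto simp: sets\<close>)
qed

lemma borel_measurable_orthogonal_transformation:
  "orthogonal_transformation f \<Longrightarrow> f \<in> borel_measurable (borel :: 'b::euclidean_space measure)"
  by (intro borel_measurable_continuous_onI linear_continuous_on)
     (simp add: orthogonal_transformation_def linear_conv_bounded_linear)

lemma nn_integral_distr_lborel_translation:
  fixes f :: "'b::euclidean_space \<Rightarrow> 'b" and F :: "'b \<Rightarrow> ennreal"
  assumes orthogonal_f: "orthogonal_transformation f"
    and [measurable]: "F \<in> borel_measurable borel"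
  shows "(\<integral>\<^sup>+x. F (x + c) \<partial>distr lborel borel f) = (\<integral>\<^sup>+x. F x \<partial>distr lborel borel f)"
proof -
  have [measurable]: "f \<in> borel_measurable borel"
    by (rule borel_measurable_orthogonal_transformation[OF orthogonal_f])
  obtain c' where c_eq: "c = f c'"
    using orthogonal_transformation_surj[OF orthogonal_f] by blast
  have "(\<integral>\<^sup>+x. F (x + c) \<partial>distr lborel borel f) = (\<integral>\<^sup>+x. F (f (c' + x)) \<partial>lborel)"
    using orthogonal_f
    by (simp add: nn_integral_distr c_eq linear_add orthogonal_transformation_def
        add.commute)
  also have "\<dots> = (\<integral>\<^sup>+x. F (f x) \<partial>lborel)"
    by (rule nn_integral_lborel_translation) measurable
  finally show ?thesis by (simp add: nn_integral_distr)
qed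

lemma distr_lborel_orthogonal_transformation:
  fixes f :: "'b::euclidean_space \<Rightarrow> 'b"
  assumes orthogonal_f: "orthogonal_transformation f"
  shows "distr lborel borel f = lborel"
proof (rule measure_eqI)
  define N where "N = distr lborel borel f"
  have [measurable]: "f \<in> borel_measurable borel"
    by (rule borel_measurable_orthogonal_transformation[OF orthogonal_f])
  have sets_N [measurable_cong, simp]: "sets N = sets borel" by (simp add: N_def)
  have N_ball: "emeasure N (ball 0 r) = emeasure lborel (ball (0::'b) r)" for r
  proof -
    have "f -` ball 0 r = ball 0 r"
      using orthogonal_f by (auto simp: orthogonal_transformation_norm)
    then show ?thesis unfolding N_def by (subst emeasure_distr) auto
  qed
  have sigma_finite: "sigma_finite_measure N"
  proof (rule sigma_finite_measure_if_ball_finite)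
    show "emeasure N (ball 0 r) \<noteq> \<infinity>" for r
      using emeasure_bounded_finite[of "ball (0::'b) r"] by (simp add: N_ball)
  qed simp
  define B where "B = ball (0::'b) 1"
  have emeasure_B: "emeasure lborel B \<noteq> \<top>" "emeasure lborel B \<noteq> 0"
    using emeasure_bounded_finite[of B] content_ball_pos[of 1 "0::'b"]
    by (auto simp: B_def measure_def)
  have "uminus ` B = B"
    by (auto simp: B_def image_iff) (metis mem_ball_0 minus_minus norm_minus_cancel)
  fix A assume "A \<in> sets (distr lborel borel f)"
  then have "emeasure N A * emeasure lborel B = emeasure lborel A * emeasure N (uminus ` B)"
    unfolding N_def
    by (intro translation_invariant_mult_lborel nn_integral_distr_lborel_translation orthogonal_f)
      (use sigma_finite in \<open>auto simp: B_def N_def\<close>)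
  also have "\<dots> = emeasure lborel A * emeasure lborel B"
    unfolding \<open>uminus ` B = B\<close> unfolding B_def N_ball ..
  finally show "emeasure (distr lborel borel f) A = emeasure lborel A"
    using emeasure_B
    by (simp add: N_def mult.commute[of _ "emeasure lborel B"] ennreal_mult_cancel_left)
qed simp

text \<open>Pushing the uniform distribution forward to the ambient space turns measurability into plain
  Borel measurability.\<close>

definition sphere_law :: "'a::euclidean_space measure" where
  "sphere_law = distr uniform_sphere borel (\<lambda>x. x)"

lemma space_sphere_law [simp]: "space sphere_law = UNIV"
  and sets_sphere_law [simp, measurable_cong]: "sets sphere_law = sets borel"
  by (simp_all add: sphere_law_def)

lemma measurable_ident_uniform_sphere [simp]: "(\<lambda>x. x) \<in> uniform_sphere \<rightarrow>\<^sub>M borel"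
  by (simp add: measurable_cong_sets[OF sets_uniform_sphere refl] measurable_restrict_space1)

lemma prob_space_sphere_law: "prob_space (sphere_law :: 'a::euclidean_space measure)"
  unfolding sphere_law_def
  by (rule prob_space.prob_space_distr[OF prob_space_uniform_sphere
      measurable_ident_uniform_sphere])

lemma AE_sphere_law_norm: "AE x in sphere_law. norm x = 1"
  unfolding sphere_law_def by (subst AE_distr_iff) auto

lemma measurable_uniform_measure_iff [simp]:
  "f \<in> uniform_measure M A \<rightarrow>\<^sub>M N \<longleftrightarrow> f \<in> M \<rightarrow>\<^sub>M N"
  by (simp add: measurable_cong_sets[OF sets_uniform_measure refl])

lemma sphere_law_eq_distr_sgn:
  "(sphere_law :: 'a::euclidean_space measure)
      = distr (uniform_measure lborel (cball 0 1)) borel sgn"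
proof (rule measure_eqI)
  fix A :: "'a set" assume "A \<in> sets sphere_law"
  then have [measurable]: "A \<in> sets borel" by simp
  have [measurable]: "sgn -` A \<in> sets borel" by (rule measurable_sets_borel) measurable
  let ?cone = "{r *\<^sub>R x | r x. 0 < r \<and> r \<le> 1 \<and> x \<in> sphere 0 1 \<inter> A}"
  have cone: "?cone = cball 0 1 \<inter> sgn -` A - {0}" (is "_ = ?S")
  proof (intro equalityI subsetI)
    fix y assume "y \<in> ?S"
    then have "y = norm y *\<^sub>R sgn y" "0 < norm y" "norm y \<le> 1" "sgn y \<in> sphere 0 1 \<inter> A"
      by (auto simp: sgn_div_norm)
    then show "y \<in> ?cone" by blast
  qed (auto simp: sgn_div_norm)
  have "emeasure sphere_law A = emeasure uniform_sphere (A \<inter> sphere 0 1)"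
    by (simp add: sphere_law_def emeasure_distr)
  also have "\<dots> = emeasure sphere_area (sphere 0 1 \<inter> A) / emeasure sphere_area (sphere (0::'a) 1)"
    unfolding uniform_sphere_def
    by (subst emeasure_uniform_measure) (auto simp: sets_restrict_space Int_ac)
  also have "\<dots> = (of_nat DIM('a) * emeasure lborel ?cone)
      / (of_nat DIM('a) * emeasure lborel (cball (0::'a) 1))"
    by (subst emeasure_sphere_area) (auto simp: emeasure_sphere_area_sphere)
  also have "\<dots> = emeasure lborel ?cone / emeasure lborel (cball (0::'a) 1)"
    by (simp add: mult.commute[of "of_nat _"] divide_mult_eq)
  also have "emeasure lborel ?cone = emeasure lborel (cball 0 1 \<inter> sgn -` A)"
    unfolding cone by (rule emeasure_Diff_null_set) auto
  also have "\<dots> / emeasure lborel (cball (0::'a) 1)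
      = emeasure (distr (uniform_measure lborel (cball 0 1)) borel sgn) A"
    by (subst emeasure_distr) (auto intro!: emeasure_uniform_measure[symmetric])
  finally show "emeasure sphere_law A
      = emeasure (distr (uniform_measure lborel (cball 0 1)) borel sgn) A" .
qed simp

lemma distr_uniform_measure_invariant:
  assumes [measurable]: "f \<in> M \<rightarrow>\<^sub>M M" "A \<in> sets M" and "distr M M f = M" "f -` A \<inter> space M = A"
  shows "distr (uniform_measure M A) M f = uniform_measure M A"
proof (rule measure_eqI)
  fix B assume "B \<in> sets (distr (uniform_measure M A) M f)"
  then have [measurable]: "B \<in> sets M" by simp
  have "A \<inter> (f -` B \<inter> space M) = f -` (A \<inter> B) \<inter> space M" using assms(4) by auto
  then have "emeasure M (A \<inter> (f -` B \<inter> space M)) = emeasure (distr M M f) (A \<inter> B)"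
    by (simp add: emeasure_distr)
  then show "emeasure (distr (uniform_measure M A) M f) B = emeasure (uniform_measure M A) B"
    by (simp add: emeasure_distr assms(3))
qed simp

theorem distr_sphere_law_orthogonal_transformation:
  fixes f :: "'a::euclidean_space \<Rightarrow> 'a"
  assumes orthogonal_f: "orthogonal_transformation f"
  shows "distr sphere_law borel f = sphere_law"
proof -
  have [measurable]: "f \<in> borel_measurable borel"
    by (rule borel_measurable_orthogonal_transformation[OF orthogonal_f])
  have "f -` cball 0 1 = cball 0 1"
    using orthogonal_f by (auto simp: orthogonal_transformation_norm)
  moreover have "distr lborel lborel f = distr lborel borel f"
    by (rule distr_cong) simp_all
  ultimately have invariant: "distr (uniform_measure lborel (cball 0 1)) lborel f
      = uniform_measure lborel (cball 0 1)"
    by (intro distr_uniform_measure_invariant)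
       (auto simp: distr_lborel_orthogonal_transformation[OF orthogonal_f])
  have commute: "f \<circ> sgn = sgn \<circ> f"
    using orthogonal_f
    by (auto simp: sgn_div_norm orthogonal_transformation_def linear_scale fun_eq_iff
        orthogonal_transformation_norm[OF orthogonal_f])
  have "distr sphere_law borel f = distr (uniform_measure lborel (cball 0 1)) borel (f \<circ> sgn)"
    unfolding sphere_law_eq_distr_sgn by (rule distr_distr) simp_all
  also have "\<dots> = distr (distr (uniform_measure lborel (cball 0 1)) lborel f) borel sgn"
    unfolding commute by (rule distr_distr[symmetric]) simp_all
  also have "\<dots> = sphere_law"
    unfolding invariant sphere_law_eq_distr_sgn ..
  finally show ?thesis .
qed

lemma AE_sphere_law_notin_subspace:
  fixes W :: "'a::euclidean_space set"
  assumes proper_subspace: "subspace W" "W \<noteq> UNIV"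
  shows "AE x in sphere_law. x \<notin> W"
proof -
  have "dim W < DIM('a)"
    using proper_subspace by (metis dim_eq_full dim_subset_UNIV order_le_less span_eq_iff)
  then have "W \<in> null_sets lborel"
    using negligible_lowdim[of W] closed_subspace[OF proper_subspace(1)]
    by (simp add: negligible_iff_null_sets null_sets_completion_iff)
  then have "AE x in lborel. x \<notin> W" by (rule AE_not_in)
  then have "AE x in uniform_measure lborel (cball 0 1). sgn x \<notin> W"
  proof (intro AE_uniform_measureI)
    have "x \<in> W" if "sgn x \<in> W" for x
      using subspace_scale[OF proper_subspace(1) that, of "norm x"]
      by (cases "x = 0") (auto simp: sgn_div_norm)
    with \<open>AE x in lborel. x \<notin> W\<close> show "AE x in lborel. x \<in> cball 0 1 \<longrightarrow> sgn x \<notin> W"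
      by (auto elim!: eventually_mono)
  qed simp
  then show ?thesis
    unfolding sphere_law_eq_distr_sgn using closed_subspace[OF proper_subspace(1)]
    by (subst AE_distr_iff) (auto simp: Compl_eq[symmetric])
qed

section \<open>Scalar fields with conjugation and their unitary groups\<close>

text \<open>The instances are the reals with the identity and the complex numbers with conjugation.\<close>

locale conj_field =
  fixes star :: "'a::{real_normed_field,euclidean_space} \<Rightarrow> 'a"
  assumes linear_star: "linear star"
    and star_mult: "star (a * b) = star a * star b"
    and star_star [simp]: "star (star a) = a"
    and mult_star: "a * star a = of_real ((norm a)\<^sup>2)"
begin

lemma star_add: "star (a + b) = star a + star b"
  and star_diff: "star (a - b) = star a - star b"
  and star_sum: "star (sum f I) = (\<Sum>i\<in>I. star (f i))"
  and star_0 [simp]: "star 0 = 0"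
  using linear_star by (simp_all add: linear_add linear_diff linear_sum linear_0)

lemma star_1 [simp]: "star 1 = 1"
  using mult_star[of 1] by simp

lemma star_of_real [simp]: "star (of_real r) = of_real r"
  using linear_scale[OF linear_star, of r 1] by (simp add: of_real_def)

lemma norm_star [simp]: "norm (star a) = norm a"
proof (cases "a = 0")
  case False
  have "norm a * norm (star a) = norm a * norm a"
    using arg_cong[OF mult_star[of a], of norm] by (simp add: norm_mult power2_eq_square)
  with False show ?thesis by simp
qed simp

lemma continuous_on_star [continuous_intros]:
  "continuous_on S f \<Longrightarrow> continuous_on S (\<lambda>x. star (f x))"
  using linear_star by (simp add: bounded_linear.continuous_on linear_conv_bounded_linear)

definition herm :: "'a ^ 'n \<Rightarrow> 'a ^ 'n \<Rightarrow> 'a" where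
  "herm x y = (\<Sum>i\<in>UNIV. x $ i * star (y $ i))"

lemma herm_add_left: "herm (x + y) z = herm x z + herm y z"
  and herm_diff_left: "herm (x - y) z = herm x z - herm y z"
  and herm_diff_right: "herm z (x - y) = herm z x - herm z y"
  and herm_scale_left: "herm (c *s x) z = c * herm x z"
  and herm_scale_right: "herm z (c *s x) = star c * herm z x"
  by (simp_all add: herm_def star_add star_diff star_mult algebra_simps sum.distrib sum_subtractf
      sum_distrib_left)

lemma herm_0 [simp]: "herm 0 x = 0" "herm x 0 = 0"
  by (simp_all add: herm_def)

lemma scaleR_eq_vector_scalar_mult: "r *\<^sub>R (x :: 'a ^ 'n) = of_real r *s x"
  by (simp add: vec_eq_iff scaleR_conv_of_real[where 'a='a])

lemma herm_scaleR_left: "herm (r *\<^sub>R x) z = of_real r * herm x z"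
  and herm_scaleR_right: "herm z (r *\<^sub>R x) = of_real r * herm z x"
  by (simp_all add: scaleR_eq_vector_scalar_mult herm_scale_left herm_scale_right)

lemma herm_commute: "herm x y = star (herm y x)"
  by (simp add: herm_def star_sum star_mult mult.commute)

lemma herm_eq_0_commute: "herm x y = 0 \<longleftrightarrow> herm y x = 0"
  by (metis herm_commute star_0)

lemma herm_axis_right [simp]: "herm y (axis j 1) = y $ j"
  by (simp add: herm_def axis_def if_distrib cong: if_cong)

lemma herm_axis_left [simp]: "herm (axis j 1) y = star (y $ j)"
  using herm_commute[of "axis j 1" y] by simp

lemma herm_self: "herm x x = of_real ((norm x)\<^sup>2)"
proof -
  have "herm x x = of_real (\<Sum>i\<in>UNIV. (norm (x $ i))\<^sup>2)"
    by (simp add: herm_def mult_star)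
  also have "(\<Sum>i\<in>UNIV. (norm (x $ i))\<^sup>2) = (norm x)\<^sup>2"
    by (simp add: norm_vec_def L2_set_def sum_nonneg)
  finally show ?thesis .
qed

lemma herm_self_eq_1_iff: "herm x x = 1 \<longleftrightarrow> norm x = 1"
proof -
  have "herm x x = 1 \<longleftrightarrow> of_real ((norm x)\<^sup>2) = (of_real 1 :: 'a)"
    by (simp add: herm_self)
  also have "\<dots> \<longleftrightarrow> norm x = 1"
    unfolding of_real_eq_iff by (simp add: abs_square_eq_1)
  finally show ?thesis .
qed

lemma herm_self_unit [simp]: "norm x = 1 \<Longrightarrow> herm x x = 1"
  by (simp add: herm_self_eq_1_iff)

lemma norm_eq_iff_herm_self: "norm x = norm y \<longleftrightarrow> herm x x = herm y y"
  by (simp add: herm_self del: of_real_power)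

lemma norm_axis_one [simp]: "norm (axis i (1::'a)) = 1"
  unfolding herm_self_eq_1_iff[symmetric] herm_axis_right by (simp add: axis_def)

lemma norm_vector_scalar_mult: "norm (c *s (x :: 'a ^ 'n)) = norm c * norm x"
proof -
  have "herm (c *s x) (c *s x) = (c * star c) * herm x x"
    by (simp add: herm_scale_left herm_scale_right)
  then have "(norm (c *s x))\<^sup>2 = (norm c * norm x)\<^sup>2"
    by (simp only: herm_self mult_star of_real_mult[symmetric] of_real_eq_iff power_mult_distrib)
  then show ?thesis by (simp add: power2_eq_iff_nonneg)
qed

lemma continuous_on_herm [continuous_intros]:
  "continuous_on S f \<Longrightarrow> continuous_on S g \<Longrightarrow> continuous_on S (\<lambda>x. herm (f x) (g x))"
  unfolding herm_def by (intro continuous_intros)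

subsection \<open>Rejection and overlap\<close>

definition rejection :: "'a ^ 'n \<Rightarrow> 'a ^ 'n \<Rightarrow> 'a ^ 'n" where
  "rejection x z = z - herm z x *s x"

definition overlap :: "'a ^ 'n \<Rightarrow> 'a ^ 'n \<Rightarrow> real" where
  "overlap x y = (norm (herm x y))\<^sup>2"

lemma overlap_nonneg [simp]: "0 \<le> overlap x y"
  by (simp add: overlap_def)

lemma herm_rejection_left [simp]: "norm x = 1 \<Longrightarrow> herm (rejection x z) x = 0"
  by (simp add: rejection_def herm_diff_left herm_scale_left)

lemma herm_rejection_right [simp]: "norm x = 1 \<Longrightarrow> herm x (rejection x z) = 0"
  by (simp add: herm_eq_0_commute[of x])

lemma norm_rejection:
  assumes "norm x = 1"
  shows "(norm (rejection x z))\<^sup>2 = (norm z)\<^sup>2 - overlap z x"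
proof -
  have "herm (rejection x z) (rejection x z) = herm (rejection x z) z"
    using assms by (subst (2) rejection_def) (simp add: herm_diff_right herm_scale_right)
  also have "\<dots> = herm z z - herm z x * star (herm z x)"
    by (simp add: rejection_def herm_diff_left herm_scale_left herm_commute[of x z])
  also have "\<dots> = of_real ((norm z)\<^sup>2 - overlap z x)"
    by (simp add: herm_self mult_star overlap_def)
  finally show ?thesis
    by (simp only: herm_self of_real_eq_iff)
qed

lemma overlap_le_1:
  assumes "norm x = 1" "norm z = 1" shows "overlap z x \<le> 1"
  using norm_rejection[OF assms(1), of z] zero_le_power2[of "norm (rejection x z)"] assms by simp

lemma ex_phase_norm_diff:
  assumes "norm a = 1" "norm x = 1"
  obtains c where "norm c = 1" "(norm (a - c *s x))\<^sup>2 \<le> 2 * (1 - overlap a x)"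
proof -
  define t where "t = norm (herm a x)"
  define c where "c = (if t = 0 then 1 else herm a x / of_real t)"
  have norm_c: "norm c = 1" by (simp add: c_def t_def norm_divide)
  have star_c_mult: "star c * herm a x = of_real t"
  proof (cases "t = 0")
    case False
    then have "herm a x = c * of_real t" by (simp add: c_def)
    then have "star c * herm a x = (c * star c) * of_real t" by (simp add: mult_ac)
    then show ?thesis by (simp add: mult_star norm_c)
  qed (simp add: t_def)
  then have c_mult: "c * herm x a = of_real t"
    by (metis herm_commute star_mult star_of_real star_star)
  have "herm (a - c *s x) (a - c *s x) = 1 - star c * herm a x - c * herm x a + c * star c"
    using assms
    by (simp add: herm_diff_left herm_diff_right herm_scale_left herm_scale_right algebra_simps)
  also have "\<dots> = of_real (2 - 2 * t)" by (simp add: star_c_mult c_mult mult_star norm_c)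
  finally have "(norm (a - c *s x))\<^sup>2 = 2 - 2 * t" by (simp only: herm_self of_real_eq_iff)
  also have "\<dots> \<le> 2 * (1 - overlap a x)"
  proof -
    have "t\<^sup>2 \<le> 1" using overlap_le_1[OF assms(2,1)] by (simp add: overlap_def t_def)
    then have "t \<le> 1" by (intro power2_le_imp_le[of t 1]) auto
    then have "t * t \<le> t" by (intro mult_left_le) (auto simp: t_def)
    then show ?thesis by (simp add: overlap_def t_def power2_eq_square)
  qed
  finally show ?thesis using that norm_c by blast
qed

subsection \<open>The unitary group\<close>

definition adjoint_matrix :: "'a ^ 'n ^ 'm \<Rightarrow> 'a ^ 'm ^ 'n" where
  "adjoint_matrix A = (\<chi> i j. star (A $ j $ i))"

definition unitaries :: "('a ^ 'n ^ 'n) set" where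
  "unitaries = {A. adjoint_matrix A ** A = mat 1 \<and> A ** adjoint_matrix A = mat 1}"

lemma adjoint_matrix_adjoint_matrix [simp]: "adjoint_matrix (adjoint_matrix A) = A"
  by (simp add: adjoint_matrix_def vec_eq_iff)

lemma adjoint_matrix_mult: "adjoint_matrix (A ** B) = adjoint_matrix B ** adjoint_matrix A"
  by (simp add: adjoint_matrix_def matrix_matrix_mult_def vec_eq_iff star_sum star_mult
      mult.commute)

lemma herm_adjoint_matrix: "herm (A *v x) y = herm x (adjoint_matrix A *v y)"
proof -
  have "herm (A *v x) y = (\<Sum>i\<in>UNIV. \<Sum>j\<in>UNIV. A $ i $ j * x $ j * star (y $ i))"
    by (simp add: herm_def matrix_vector_mult_def sum_distrib_right)
  also have "\<dots> = (\<Sum>j\<in>UNIV. \<Sum>i\<in>UNIV. A $ i $ j * x $ j * star (y $ i))"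
    by (rule sum.swap)
  also have "\<dots> = herm x (adjoint_matrix A *v y)"
    by (simp add: herm_def matrix_vector_mult_def adjoint_matrix_def star_sum star_mult
        sum_distrib_left mult_ac)
  finally show ?thesis .
qed

lemma herm_unitary [simp]: "A \<in> unitaries \<Longrightarrow> herm (A *v x) (A *v y) = herm x y"
  by (simp add: herm_adjoint_matrix matrix_vector_mul_assoc unitaries_def)

lemma overlap_unitary [simp]: "A \<in> unitaries \<Longrightarrow> overlap (A *v x) (A *v y) = overlap x y"
  by (simp add: overlap_def)

lemma norm_unitary [simp]: "A \<in> unitaries \<Longrightarrow> norm (A *v x) = norm x"
  by (simp add: norm_eq_iff_herm_self)

lemma mat_1_unitary: "mat 1 \<in> unitaries"
proof -
  have "adjoint_matrix (mat 1) = mat 1" by (simp add: adjoint_matrix_def mat_def vec_eq_iff)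
  then show ?thesis by (simp add: unitaries_def)
qed

lemma mult_unitary: assumes "A \<in> unitaries" "B \<in> unitaries" shows "A ** B \<in> unitaries"
proof -
  have "adjoint_matrix B ** adjoint_matrix A ** (A ** B)
      = adjoint_matrix B ** (adjoint_matrix A ** A) ** B"
    "A ** B ** (adjoint_matrix B ** adjoint_matrix A)
        = A ** (B ** adjoint_matrix B) ** adjoint_matrix A"
    by (simp_all add: matrix_mul_assoc)
  then show ?thesis using assms by (simp add: unitaries_def adjoint_matrix_mult)
qed

lemma adjoint_matrix_unitary: "A \<in> unitaries \<Longrightarrow> adjoint_matrix A \<in> unitaries"
  by (simp add: unitaries_def)

lemma orthogonal_transformation_unitary:
  assumes "A \<in> unitaries" shows "orthogonal_transformation ((*v) (A :: 'a ^ 'n ^ 'n))"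
proof -
  have "linear ((*v) A)"
    by (rule linearI)
       (simp_all add: matrix_vector_right_distrib scaleR_eq_vector_scalar_mult
           vector_scalar_commute)
  then show ?thesis using assms by (simp add: orthogonal_transformation)
qed

lemma rejection_unitary: "A \<in> unitaries \<Longrightarrow> rejection (A *v x) (A *v z) = A *v rejection x z"
  by (simp add: rejection_def matrix_vector_mult_diff_distrib vector_scalar_commute)

lemma closed_unitaries: "closed unitaries"
proof -
  have "continuous_on UNIV (\<lambda>A :: 'a ^ 'n ^ 'n. adjoint_matrix A ** A)"
    "continuous_on UNIV (\<lambda>A :: 'a ^ 'n ^ 'n. A ** adjoint_matrix A)"
    by (auto simp: matrix_matrix_mult_def adjoint_matrix_def intro!: continuous_intros)
  then show ?thesis
    unfolding unitaries_def by (intro closed_Collect_conj closed_Collect_eq continuous_intros)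
qed

text \<open>For \<open>c = -1\<close> this is the Householder reflection along \<open>w\<close>; over the complex numbers the
  additional phases are needed for transitivity on the sphere.\<close>

definition reflection :: "'a ^ 'n \<Rightarrow> 'a \<Rightarrow> 'a ^ 'n ^ 'n" where
  "reflection w c = (\<chi> i j. (if i = j then 1 else 0) + (c - 1) * w $ i * star (w $ j))"

lemma reflection_mult_vec: "reflection w c *v z = z + ((c - 1) * herm z w) *s w"
proof -
  have "(\<Sum>j\<in>UNIV. ((if i = j then 1 else 0) + (c - 1) * w $ i * star (w $ j)) * z $ j) =
      (\<Sum>j\<in>UNIV. (if i = j then z $ j else 0))
      + (\<Sum>j\<in>UNIV. (c - 1) * w $ i * star (w $ j) * z $ j)" for i
    unfolding sum.distrib[symmetric] by (intro sum.cong) (auto simp: algebra_simps)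
  then show ?thesis
    by (simp add: vec_eq_iff matrix_vector_mult_def reflection_def herm_def sum_distrib_left
        sum_distrib_right mult_ac)
qed

lemma reflection_mult_reflection:
  assumes "norm w = 1" "c * c' = 1" shows "reflection w c ** reflection w c' = mat 1"
proof -
  have "reflection w c *v (reflection w c' *v z) = z" for z
  proof -
    have "reflection w c *v (reflection w c' *v z) = z + ((c * c' - 1) * herm z w) *s w"
      using assms(1)
      by (simp add: reflection_mult_vec herm_add_left herm_scale_left vec_eq_iff algebra_simps)
    then show ?thesis using assms(2) by simp
  qed
  then show ?thesis by (simp add: matrix_eq matrix_vector_mul_assoc[symmetric])
qed

lemma reflection_unitary:
  assumes "norm w = 1" "norm c = 1"
  shows "reflection w c \<in> unitaries"
proof -
  have "adjoint_matrix (reflection w c) = reflection w (star c)"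
    by (simp add: adjoint_matrix_def reflection_def vec_eq_iff star_add star_mult star_diff
        mult_ac)
  moreover have "c * star c = 1" using mult_star[of c] assms by simp
  ultimately show ?thesis
    using assms by (simp add: unitaries_def reflection_mult_reflection mult.commute)
qed

lemma ex_phase_reflection:
  assumes distinct_unit_vectors: "norm x = 1" "norm y = 1" "x \<noteq> y"
  obtains c where "norm c = 1" "reflection (sgn (x - y)) c *v x = y"
proof -
  define t where "t = herm x y"
  define n where "n = norm (x - y)"
  have n_pos: "n > 0" using distinct_unit_vectors by (simp add: n_def)
  have n_power2: "of_real (n\<^sup>2) = 2 - t - star t"
    using herm_self[of "x - y"] herm_commute[of y x] distinct_unit_vectors
    by (simp add: n_def t_def herm_diff_left herm_diff_right algebra_simps)
  have t_neq_1: "1 - t \<noteq> 0"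
  proof
    assume "1 - t = 0"
    then have "of_real (n\<^sup>2) = (0::'a)" using n_power2 by simp
    then show False using n_pos by simp
  qed
  have star_1_diff: "1 - star t = star (1 - t)" by (simp add: star_diff)
  define c where "c = - ((1 - star t) / (1 - t))"
  have norm_c: "norm c = 1"
    using t_neq_1 by (simp add: c_def norm_divide star_1_diff)
  have sgn_eq: "sgn (x - y) = of_real (1 / n) *s (x - y)"
    by (simp add: sgn_div_norm n_def scaleR_eq_vector_scalar_mult divide_inverse)
  have "(c - 1) * herm x (sgn (x - y)) * of_real (1 / n) = (c - 1) * (1 - t) / of_real (n\<^sup>2)"
    using distinct_unit_vectors
    by (simp only: sgn_eq herm_scale_right star_of_real herm_diff_right t_def herm_self_unit)
       (simp add: power2_eq_square)
  also have "(c - 1) * (1 - t) = - of_real (n\<^sup>2)"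
    unfolding n_power2 using t_neq_1 by (simp add: c_def field_simps)
  finally have "(c - 1) * herm x (sgn (x - y)) * of_real (1 / n) = - 1"
    using n_pos by simp
  then have "((c - 1) * herm x (sgn (x - y))) *s sgn (x - y) = y - x"
    by (subst (2) sgn_eq) (simp add: vector_smult_assoc mult_ac)
  then have "reflection (sgn (x - y)) c *v x = y" by (simp add: reflection_mult_vec)
  then show ?thesis using that norm_c by blast
qed

lemma ex_unitary_fixing_complement:
  assumes "norm x = 1" "norm y = 1"
  obtains A where "A \<in> unitaries" "A *v x = y" "\<And>z. herm z x = 0 \<Longrightarrow> herm z y = 0 \<Longrightarrow> A *v z = z"
proof (cases "x = y")
  case True
  then show ?thesis using that[of "mat 1"] mat_1_unitary by simp
next
  case False
  then obtain c where phase_c: "norm c = 1" "reflection (sgn (x - y)) c *v x = y"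
    using ex_phase_reflection assms by metis
  moreover have "reflection (sgn (x - y)) c *v z = z" if "herm z x = 0" "herm z y = 0" for z
    using that by (simp add: reflection_mult_vec sgn_div_norm herm_scaleR_right herm_diff_right)
  ultimately show ?thesis
    using that[of "reflection (sgn (x - y)) c"] False reflection_unitary[of "sgn (x - y)" c]
    by (simp add: norm_sgn)
qed

definition orthonormal_pair :: "'a ^ 'n \<Rightarrow> 'a ^ 'n \<Rightarrow> bool" where
  "orthonormal_pair x y \<longleftrightarrow> norm x = 1 \<and> norm y = 1 \<and> herm x y = 0"

lemma orthonormal_pair_commute: "orthonormal_pair x y \<Longrightarrow> orthonormal_pair y x"
  by (simp add: orthonormal_pair_def herm_eq_0_commute)

lemma ex_unitary_orthonormal_pair:
  assumes "orthonormal_pair x y" "orthonormal_pair x' y'"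
  obtains A where "A \<in> unitaries" "A *v x = x'" "A *v y = y'"
proof -
  obtain A where unitary_A: "A \<in> unitaries" "A *v x = x'"
    using ex_unitary_fixing_complement[of x x'] assms by (auto simp: orthonormal_pair_def)
  obtain B where unitary_B: "B \<in> unitaries" "B *v (A *v y) = y'"
      "\<And>z. herm z (A *v y) = 0 \<Longrightarrow> herm z y' = 0 \<Longrightarrow> B *v z = z"
    using ex_unitary_fixing_complement[of "A *v y" y'] assms unitary_A
    by (auto simp: orthonormal_pair_def)
  have "herm x' (A *v y) = 0" using assms(1) unitary_A by (auto simp: orthonormal_pair_def)
  then have "B *v x' = x'" using unitary_B(3) assms(2) by (simp add: orthonormal_pair_def)
  then show ?thesis
    using that[of "B ** A"] unitary_A unitary_B(1,2) mult_unitary[OF unitary_B(1) unitary_A(1)]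
    by (simp add: matrix_vector_mul_assoc[symmetric])
qed

definition orthonormal_family :: "'i set \<Rightarrow> ('i \<Rightarrow> 'a ^ 'n) \<Rightarrow> bool" where
  "orthonormal_family I b \<longleftrightarrow> (\<forall>i\<in>I. \<forall>j\<in>I. herm (b i) (b j) = (if i = j then 1 else 0))"

lemma norm_orthonormal_family: "orthonormal_family I b \<Longrightarrow> i \<in> I \<Longrightarrow> norm (b i) = 1"
  by (simp add: orthonormal_family_def flip: herm_self_eq_1_iff)

lemma orthonormal_pair_orthonormal_family:
  "orthonormal_family I b \<Longrightarrow> i \<in> I \<Longrightarrow> j \<in> I \<Longrightarrow> i \<noteq> j \<Longrightarrow> orthonormal_pair (b i) (b j)"
  by (simp add: orthonormal_pair_def norm_orthonormal_family) (simp add: orthonormal_family_def)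

text \<open>For \<open>z\<close> uniform on the sphere, \<open>orth_dir x z\<close> is uniform on the unit vectors orthogonal to the
  unit vector \<open>x\<close>. It is \<open>0\<close> on the null set of \<open>z\<close> parallel to \<open>x\<close>.\<close>

definition orth_dir :: "'a ^ 'n \<Rightarrow> 'a ^ 'n \<Rightarrow> 'a ^ 'n" where
  "orth_dir x z = sgn (rejection x z)"

lemma orth_dir_unitary: "A \<in> unitaries \<Longrightarrow> orth_dir (A *v x) (A *v z) = A *v orth_dir x z"
  by (simp add: orth_dir_def rejection_unitary sgn_div_norm scaleR_eq_vector_scalar_mult
      vector_scalar_commute)

lemma norm_orth_dir: "rejection x z \<noteq> 0 \<Longrightarrow> norm (orth_dir x z) = 1"
  by (simp add: orth_dir_def norm_sgn)

lemma herm_orth_dir: "norm x = 1 \<Longrightarrow> herm x (orth_dir x z) = 0"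
  by (simp add: orth_dir_def sgn_div_norm herm_scaleR_right)

lemma orthonormal_pair_orth_dir:
  "norm x = 1 \<Longrightarrow> rejection x z \<noteq> 0 \<Longrightarrow> orthonormal_pair x (orth_dir x z)"
  by (simp add: orthonormal_pair_def norm_orth_dir herm_orth_dir)

lemma overlap_orth_dir_le_1:
  assumes "norm v = 1" shows "overlap v (orth_dir x z) \<le> 1"
proof (cases "rejection x z = 0")
  case False
  then show ?thesis using overlap_le_1[OF norm_orth_dir assms] by simp
qed (simp add: orth_dir_def overlap_def)

lemma orth_dir_phase:
  assumes "norm c = 1" shows "orth_dir (c *s x) z = orth_dir x z"
proof -
  have "(star c * herm z x) *s (c *s x) = (c * star c * herm z x) *s x"
    by (simp add: vector_smult_assoc mult_ac)
  then have "rejection (c *s x) z = rejection x z"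
    using assms by (simp add: rejection_def herm_scale_right mult_star)
  then show ?thesis by (simp add: orth_dir_def)
qed

text \<open>Only the component of \<open>a\<close> orthogonal to \<open>y\<close> is seen by a vector orthogonal to \<open>y\<close>.\<close>

lemma overlap_orth_dir_eq:
  assumes norm_y: "norm y = 1" and norm_a: "norm a = 1"
  shows "overlap a (orth_dir y z) = (1 - overlap a y) * overlap (orth_dir y a) (orth_dir y z)"
proof -
  have "herm a (orth_dir y z) = herm (rejection y a) (orth_dir y z)"
    using norm_y by (simp add: rejection_def herm_diff_left herm_scale_left herm_orth_dir)
  also have "rejection y a = norm (rejection y a) *\<^sub>R orth_dir y a"
    by (cases "rejection y a = 0") (simp_all add: orth_dir_def sgn_div_norm)
  finally have "overlap a (orth_dir y z)
      = (norm (rejection y a))\<^sup>2 * overlap (orth_dir y a) (orth_dir y z)"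
    by (simp add: overlap_def herm_scaleR_left norm_mult power_mult_distrib)
  then show ?thesis using norm_rejection[OF norm_y, of a] norm_a by simp
qed

section \<open>The law of a random orthonormal pair\<close>

lemma borel_measurable_matrix_vector_mult [measurable (raw)]:
  fixes f :: "'b \<Rightarrow> 'a ^ 'n ^ 'm"
  assumes "f \<in> borel_measurable M" "g \<in> borel_measurable M"
  shows "(\<lambda>x. f x *v g x) \<in> borel_measurable M"
  by (rule borel_measurable_continuous_Pair[OF assms])
     (auto simp: matrix_vector_mult_def intro!: continuous_intros)

lemma borel_measurable_matrix_matrix_mult [measurable (raw)]:
  fixes f :: "'b \<Rightarrow> 'a ^ 'n ^ 'm"
  assumes "f \<in> borel_measurable M" "g \<in> borel_measurable M"
  shows "(\<lambda>x. f x ** g x) \<in> borel_measurable M"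
  by (rule borel_measurable_continuous_Pair[OF assms])
     (auto simp: matrix_matrix_mult_def intro!: continuous_intros)

lemma borel_measurable_adjoint_matrix [measurable (raw)]:
  fixes f :: "'b \<Rightarrow> 'a ^ 'n ^ 'm"
  assumes "f \<in> borel_measurable M"
  shows "(\<lambda>x. adjoint_matrix (f x)) \<in> borel_measurable M"
  by (rule borel_measurable_continuous_on[OF _ assms])
     (auto simp: adjoint_matrix_def intro!: continuous_intros)

lemma continuous_on_overlap [continuous_intros]:
  "continuous_on S f \<Longrightarrow> continuous_on S g \<Longrightarrow> continuous_on S (\<lambda>x. overlap (f x) (g x))"
  unfolding overlap_def by (intro continuous_intros)

lemma borel_measurable_overlap [measurable (raw)]:
  fixes f :: "'b \<Rightarrow> 'a ^ 'n"
  assumes "f \<in> borel_measurable M" "g \<in> borel_measurable M"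
  shows "(\<lambda>x. overlap (f x) (g x)) \<in> borel_measurable M"
  by (rule borel_measurable_continuous_Pair[OF assms]) (auto intro!: continuous_intros)

lemma sum_overlap_axis: "(\<Sum>j\<in>UNIV. overlap (axis j 1) y) = (norm y)\<^sup>2"
  by (simp add: overlap_def norm_vec_def L2_set_def sum_nonneg)

lemma continuous_on_rejection [continuous_intros]:
  "continuous_on S f \<Longrightarrow> continuous_on S g \<Longrightarrow> continuous_on S (\<lambda>x. rejection (f x) (g x))"
  unfolding rejection_def vector_scalar_mult_def by (intro continuous_intros)

lemma borel_measurable_orth_dir [measurable (raw)]:
  fixes f :: "'b \<Rightarrow> 'a ^ 'n"
  assumes "f \<in> borel_measurable M" "g \<in> borel_measurable M"
  shows "(\<lambda>x. orth_dir (f x) (g x)) \<in> borel_measurable M"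
proof -
  have "(\<lambda>x. rejection (f x) (g x)) \<in> borel_measurable M"
    by (rule borel_measurable_continuous_Pair[OF assms]) (auto intro!: continuous_intros)
  then show ?thesis unfolding orth_dir_def by measurable
qed

lemma subspace_rejection_eq_0: "subspace {z. rejection x z = 0}"
  by (auto simp: subspace_def rejection_def herm_add_left herm_scale_left
      scaleR_eq_vector_scalar_mult vector_sadd_rdistrib simp flip: vector_smult_assoc)

lemma ex_rejection_neq_0:
  fixes x :: "'a ^ 'n"
  assumes "2 \<le> CARD('n)" obtains z where "rejection x z \<noteq> 0"
proof (rule ccontr)
  assume not_thesis: "\<not> thesis"
  obtain i j :: 'n where distinct: "i \<noteq> j"
    using assms card_le_Suc0_iff_eq[of "UNIV :: 'n set"] by fastforce
  have axis_eq: "axis k 1 = star (x $ k) *s x" for k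
    using not_thesis that[of "axis k 1"] by (auto simp: rejection_def)
  have "star (x $ k) * x $ l = (if k = l then 1 else 0)" for k l
    using arg_cong[OF axis_eq[of k], of "\<lambda>z. z $ l"] by (auto simp: axis_def)
  from this[of i j] this[of i i] this[of j j] distinct show False by auto
qed

end

locale haar_unitary = conj_field star
  for star :: "'a::{real_normed_field,euclidean_space} \<Rightarrow> 'a" +
  fixes \<mu> :: "('a ^ 'n ^ 'n) measure"
  assumes prob_space_haar: "prob_space \<mu>"
    and sets_haar [measurable_cong, simp]: "sets \<mu> = sets borel"
    and AE_haar: "AE g in \<mu>. g \<in> unitaries"
    and distr_haar_left: "g \<in> unitaries \<Longrightarrow> distr \<mu> borel ((**) g) = \<mu>"
    and card_ge_2: "2 \<le> CARD('n)"
begin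

abbreviation \<sigma> :: "('a ^ 'n) measure" where
  "\<sigma> \<equiv> sphere_law"

sublocale haar: prob_space \<mu> by (fact prob_space_haar)
sublocale sphere: prob_space \<sigma> by (fact prob_space_sphere_law)
sublocale sphere: finite_euclidean_measure \<sigma> by standard simp
sublocale haar_sphere: pair_sigma_finite \<mu> \<sigma> ..
sublocale haar_haar: pair_sigma_finite \<mu> \<mu> ..
sublocale sphere_sphere: pair_prob_space \<sigma> \<sigma> ..

lemma space_haar [simp]: "space \<mu> = UNIV"
  using sets_eq_imp_space_eq[OF sets_haar] by simp

lemma emeasure_haar_UNIV [simp]: "emeasure \<mu> UNIV = 1"
  and emeasure_sphere_UNIV [simp]: "emeasure \<sigma> UNIV = 1"
  and measure_sphere_UNIV [simp]: "measure \<sigma> UNIV = 1"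
  using haar.emeasure_space_1 sphere.emeasure_space_1 sphere.prob_space by simp_all

lemma AE_rejection_neq_0: "AE z in \<sigma>. rejection x z \<noteq> 0"
  using AE_sphere_law_notin_subspace[OF subspace_rejection_eq_0[of x]]
    ex_rejection_neq_0[OF card_ge_2, of x]
  by auto

lemma AE_orthonormal_pair_orth_dir:
  "norm x = 1 \<Longrightarrow> AE z in \<sigma>. orthonormal_pair x (orth_dir x z)"
  using AE_rejection_neq_0 by eventually_elim (rule orthonormal_pair_orth_dir)

lemma ex_orthonormal_pair:
  assumes "norm x = 1" obtains y :: "'a ^ 'n" where "orthonormal_pair x y"
  using ex_rejection_neq_0[OF card_ge_2, of x] orthonormal_pair_orth_dir[OF assms] by metis

lemma nn_integral_haar_left:
  assumes [measurable]: "F \<in> borel_measurable borel" and "g \<in> unitaries"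
  shows "(\<integral>\<^sup>+R. F (g ** R) \<partial>\<mu>) = (\<integral>\<^sup>+R. F R \<partial>\<mu>)"
  by (subst (2) distr_haar_left[OF assms(2), symmetric]) (simp add: nn_integral_distr)

lemma nn_integral_haar_adjoint:
  assumes [measurable]: "F \<in> borel_measurable borel"
  shows "(\<integral>\<^sup>+R. F (adjoint_matrix R) \<partial>\<mu>) = (\<integral>\<^sup>+R. F R \<partial>\<mu>)"
proof -
  have "(\<integral>\<^sup>+R. F R \<partial>\<mu>) = (\<integral>\<^sup>+S. (\<integral>\<^sup>+R. F (adjoint_matrix S ** R) \<partial>\<mu>) \<partial>\<mu>)"
  proof -
    have "AE S in \<mu>. (\<integral>\<^sup>+R. F (adjoint_matrix S ** R) \<partial>\<mu>) = (\<integral>\<^sup>+R. F R \<partial>\<mu>)"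
      using AE_haar by eventually_elim (simp add: nn_integral_haar_left adjoint_matrix_unitary)
    from nn_integral_cong_AE[OF this] show ?thesis by simp
  qed
  also have "\<dots> = (\<integral>\<^sup>+R. (\<integral>\<^sup>+S. F (adjoint_matrix S ** R) \<partial>\<mu>) \<partial>\<mu>)"
    by (rule haar_haar.Fubini') measurable
  also have "\<dots> = (\<integral>\<^sup>+R. (\<integral>\<^sup>+S. F (adjoint_matrix (adjoint_matrix R ** S)) \<partial>\<mu>) \<partial>\<mu>)"
    by (simp add: adjoint_matrix_mult)
  also have "\<dots> = (\<integral>\<^sup>+S. F (adjoint_matrix S) \<partial>\<mu>)"
  proof -
    have "(\<integral>\<^sup>+S. F (adjoint_matrix (adjoint_matrix R ** S)) \<partial>\<mu>) = (\<integral>\<^sup>+S. F (adjoint_matrix S) \<partial>\<mu>)"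
      if "R \<in> unitaries" for R
      by (rule nn_integral_haar_left[of "\<lambda>S. F (adjoint_matrix S)"])
         (use that in \<open>simp_all add: adjoint_matrix_unitary\<close>)
    then have "AE R in \<mu>. (\<integral>\<^sup>+S. F (adjoint_matrix (adjoint_matrix R ** S)) \<partial>\<mu>)
        = (\<integral>\<^sup>+S. F (adjoint_matrix S) \<partial>\<mu>)"
      using AE_haar by (auto elim: eventually_mono)
    from nn_integral_cong_AE[OF this] show ?thesis by simp
  qed
  finally show ?thesis ..
qed

lemma nn_integral_haar_right:
  assumes [measurable]: "F \<in> borel_measurable borel" and "g \<in> unitaries"
  shows "(\<integral>\<^sup>+R. F (R ** g) \<partial>\<mu>) = (\<integral>\<^sup>+R. F R \<partial>\<mu>)"
proof -
  have "(\<integral>\<^sup>+R. F (R ** g) \<partial>\<mu>) = (\<integral>\<^sup>+R. F (adjoint_matrix R ** g) \<partial>\<mu>)"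
    by (rule nn_integral_haar_adjoint[symmetric]) measurable
  also have "\<dots> = (\<integral>\<^sup>+R. F (adjoint_matrix (adjoint_matrix g ** R)) \<partial>\<mu>)"
    by (simp add: adjoint_matrix_mult)
  also have "\<dots> = (\<integral>\<^sup>+R. F (adjoint_matrix R) \<partial>\<mu>)"
    by (rule nn_integral_haar_left[of "\<lambda>S. F (adjoint_matrix S)"])
       (use assms in \<open>simp_all add: adjoint_matrix_unitary\<close>)
  also have "\<dots> = (\<integral>\<^sup>+R. F R \<partial>\<mu>)"
    by (rule nn_integral_haar_adjoint) measurable
  finally show ?thesis .
qed

lemma nn_integral_sphere_unitary:
  assumes [measurable]: "F \<in> borel_measurable borel" and "g \<in> unitaries"
  shows "(\<integral>\<^sup>+x. F (g *v x) \<partial>\<sigma>) = (\<integral>\<^sup>+x. F x \<partial>\<sigma>)"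
  by (subst (2) distr_sphere_law_orthogonal_transformation[symmetric],
      rule orthogonal_transformation_unitary[OF assms(2)])
     (simp add: nn_integral_distr)

lemma integral_sphere_unitary:
  fixes F :: "'a ^ 'n \<Rightarrow> real"
  assumes [measurable]: "F \<in> borel_measurable borel" and "g \<in> unitaries"
  shows "(\<integral>x. F (g *v x) \<partial>\<sigma>) = (\<integral>x. F x \<partial>\<sigma>)"
  by (subst (2) distr_sphere_law_orthogonal_transformation[symmetric],
      rule orthogonal_transformation_unitary[OF assms(2)])
     (simp add: integral_distr)

lemma nn_integral_haar_pair_cong:
  assumes [measurable]: "\<Phi> \<in> borel_measurable borel"
    and "orthonormal_pair x y" "orthonormal_pair x' y'"
  shows "(\<integral>\<^sup>+R. \<Phi> (R *v x', R *v y') \<partial>\<mu>) = (\<integral>\<^sup>+R. \<Phi> (R *v x, R *v y) \<partial>\<mu>)"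
proof -
  obtain A where unitary_A: "A \<in> unitaries" "A *v x = x'" "A *v y = y'"
    using ex_unitary_orthonormal_pair assms(2,3) by blast
  show ?thesis
    using nn_integral_haar_right[of "\<lambda>R. \<Phi> (R *v x, R *v y)", OF _ unitary_A(1)]
    by (simp add: unitary_A(2,3) flip: matrix_vector_mul_assoc)
qed

lemma nn_integral_orth_dir_unitary:
  assumes [measurable]: "\<Phi> \<in> borel_measurable borel" and unitary_R: "R \<in> unitaries"
  shows "(\<integral>\<^sup>+x. (\<integral>\<^sup>+z. \<Phi> (R *v x, R *v orth_dir x z) \<partial>\<sigma>) \<partial>\<sigma>)
    = (\<integral>\<^sup>+x. (\<integral>\<^sup>+z. \<Phi> (x, orth_dir x z) \<partial>\<sigma>) \<partial>\<sigma>)"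
proof -
  have "(\<integral>\<^sup>+x. (\<integral>\<^sup>+z. \<Phi> (R *v x, R *v orth_dir x z) \<partial>\<sigma>) \<partial>\<sigma>)
      = (\<integral>\<^sup>+x. (\<integral>\<^sup>+z. \<Phi> (R *v x, orth_dir (R *v x) (R *v z)) \<partial>\<sigma>) \<partial>\<sigma>)"
    by (simp add: orth_dir_unitary unitary_R)
  also have "\<dots> = (\<integral>\<^sup>+x. (\<integral>\<^sup>+z. \<Phi> (R *v x, orth_dir (R *v x) z) \<partial>\<sigma>) \<partial>\<sigma>)"
    by (intro nn_integral_cong nn_integral_sphere_unitary[OF _ unitary_R]) measurable
  also have "\<dots> = (\<integral>\<^sup>+x. (\<integral>\<^sup>+z. \<Phi> (x, orth_dir x z) \<partial>\<sigma>) \<partial>\<sigma>)"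
    by (rule nn_integral_sphere_unitary[OF _ unitary_R]) measurable
  finally show ?thesis .
qed

text \<open>The right hand side is invariant under rotation of \<open>(x, orth_dir x z)\<close> by \<open>R\<close>; averaging
  over \<open>R\<close> first gives the left hand side for each of these pairs.\<close>

lemma nn_integral_haar_pair:
  assumes [measurable]: "\<Phi> \<in> borel_measurable borel" and orthonormal_xy: "orthonormal_pair x y"
  shows "(\<integral>\<^sup>+R. \<Phi> (R *v x, R *v y) \<partial>\<mu>) = (\<integral>\<^sup>+x. (\<integral>\<^sup>+z. \<Phi> (x, orth_dir x z) \<partial>\<sigma>) \<partial>\<sigma>)"
proof -
  let ?c = "\<integral>\<^sup>+R. \<Phi> (R *v x, R *v y) \<partial>\<mu>"
  have "(\<integral>\<^sup>+x. (\<integral>\<^sup>+z. \<Phi> (x, orth_dir x z) \<partial>\<sigma>) \<partial>\<sigma>)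
      = (\<integral>\<^sup>+R. (\<integral>\<^sup>+x. (\<integral>\<^sup>+z. \<Phi> (R *v x, R *v orth_dir x z) \<partial>\<sigma>) \<partial>\<sigma>) \<partial>\<mu>)"
  proof -
    have "AE R in \<mu>. (\<integral>\<^sup>+x. (\<integral>\<^sup>+z. \<Phi> (R *v x, R *v orth_dir x z) \<partial>\<sigma>) \<partial>\<sigma>)
        = (\<integral>\<^sup>+x. (\<integral>\<^sup>+z. \<Phi> (x, orth_dir x z) \<partial>\<sigma>) \<partial>\<sigma>)"
      using AE_haar by eventually_elim (rule nn_integral_orth_dir_unitary[OF assms(1)])
    from nn_integral_cong_AE[OF this] show ?thesis by simp
  qed
  also have "\<dots> = (\<integral>\<^sup>+x. (\<integral>\<^sup>+R. (\<integral>\<^sup>+z. \<Phi> (R *v x, R *v orth_dir x z) \<partial>\<sigma>) \<partial>\<mu>) \<partial>\<sigma>)"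
    by (rule haar_sphere.Fubini'[symmetric]) measurable
  also have "\<dots> = (\<integral>\<^sup>+x. (\<integral>\<^sup>+z. (\<integral>\<^sup>+R. \<Phi> (R *v x, R *v orth_dir x z) \<partial>\<mu>) \<partial>\<sigma>) \<partial>\<sigma>)"
    by (intro nn_integral_cong haar_sphere.Fubini'[symmetric]) measurable
  also have "\<dots> = (\<integral>\<^sup>+x. ?c \<partial>\<sigma>)"
  proof (rule nn_integral_cong_AE)
    have "(\<integral>\<^sup>+z. (\<integral>\<^sup>+R. \<Phi> (R *v u, R *v orth_dir u z) \<partial>\<mu>) \<partial>\<sigma>) = ?c" if "norm u = 1" for u
    proof -
      have "AE z in \<sigma>. (\<integral>\<^sup>+R. \<Phi> (R *v u, R *v orth_dir u z) \<partial>\<mu>) = ?c"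
        using AE_orthonormal_pair_orth_dir[OF that]
        by eventually_elim (rule nn_integral_haar_pair_cong[OF assms])
      from nn_integral_cong_AE[OF this] show ?thesis by simp
    qed
    then show "AE u in \<sigma>. (\<integral>\<^sup>+z. (\<integral>\<^sup>+R. \<Phi> (R *v u, R *v orth_dir u z) \<partial>\<mu>) \<partial>\<sigma>) = ?c"
      using AE_sphere_law_norm by (auto elim: eventually_mono)
  qed
  finally show ?thesis by simp
qed

lemma distr_haar_pair:
  assumes "orthonormal_pair x y"
  shows "distr \<mu> (borel \<Otimes>\<^sub>M borel) (\<lambda>R. (R *v x, R *v y))
      = distr (\<sigma> \<Otimes>\<^sub>M \<sigma>) (borel \<Otimes>\<^sub>M borel) (\<lambda>(x, z). (x, orth_dir x z))"
    (is "?L = ?R")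
proof (rule measure_eqI)
  fix A assume "A \<in> sets ?L"
  then have sets_A [measurable]: "A \<in> sets (borel \<Otimes>\<^sub>M borel)" by simp
  then have [measurable]: "A \<in> sets borel" by (simp only: borel_prod)
  have "emeasure ?L A = (\<integral>\<^sup>+p. indicator A p \<partial>?L)" using sets_A by simp
  also have "\<dots> = (\<integral>\<^sup>+R. indicator A (R *v x, R *v y) \<partial>\<mu>)"
    by (rule nn_integral_distr) measurable
  also have "\<dots> = (\<integral>\<^sup>+x. (\<integral>\<^sup>+z. indicator A (x, orth_dir x z) \<partial>\<sigma>) \<partial>\<sigma>)"
    by (rule nn_integral_haar_pair[OF _ assms]) measurable
  also have "\<dots> = (\<integral>\<^sup>+p. indicator A (case p of (x, z) \<Rightarrow> (x, orth_dir x z)) \<partial>(\<sigma> \<Otimes>\<^sub>M \<sigma>))"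
    by (subst sphere.nn_integral_fst[symmetric]) simp_all
  also have "\<dots> = (\<integral>\<^sup>+p. indicator A p \<partial>?R)"
    by (rule nn_integral_distr[symmetric]) measurable
  finally show "emeasure ?L A = emeasure ?R A" using sets_A by simp
qed simp

lemma distr_haar_unit_vector:
  assumes "norm x = 1" shows "distr \<mu> borel (\<lambda>R. R *v x) = \<sigma>"
proof -
  obtain y where orthonormal_xy: "orthonormal_pair x y" using ex_orthonormal_pair[OF assms] .
  have "distr \<mu> borel (\<lambda>R. R *v x)
      = distr (distr \<mu> (borel \<Otimes>\<^sub>M borel) (\<lambda>R. (R *v x, R *v y))) borel fst"
    by (subst distr_distr) (simp_all add: comp_def)
  also have "\<dots> = distr (\<sigma> \<Otimes>\<^sub>M \<sigma>) borel fst"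
    unfolding distr_haar_pair[OF orthonormal_xy]
    by (subst distr_distr) (simp_all add: comp_def case_prod_beta)
  also have "\<dots> = distr (\<sigma> \<Otimes>\<^sub>M \<sigma>) \<sigma> fst"
    by (rule distr_cong) simp_all
  also have "\<dots> = \<sigma>" by (rule sphere.distr_pair_fst)
  finally show ?thesis .
qed

end

section \<open>Averaging over the orthogonal complement\<close>

lemma log_convex_geometric_le:
  fixes a :: "nat \<Rightarrow> real"
  assumes log_convex: "\<And>n. (a (Suc n))\<^sup>2 \<le> a n * a (Suc (Suc n))"
    and pos_start: "0 < a 0" "0 < a 1"
  shows "a 0 * (a 1 / a 0) ^ n \<le> a n"
proof -
  define r where "r = a 1 / a 0"
  have r_pos: "0 < r" using pos_start by (simp add: r_def)
  have pos_and_ratio: "0 < a n \<and> r * a n \<le> a (Suc n)" for n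
  proof (induction n)
    case 0
    then show ?case using pos_start by (simp add: r_def)
  next
    case (Suc n)
    then have pos_Suc: "0 < a (Suc n)" using r_pos by (meson less_le_trans mult_pos_pos)
    have "r * a n * a (Suc n) \<le> a (Suc n) * a (Suc n)"
      using Suc pos_Suc by (intro mult_right_mono) auto
    also have "\<dots> \<le> a n * a (Suc (Suc n))" using log_convex[of n] by (simp add: power2_eq_square)
    finally have "a n * (r * a (Suc n)) \<le> a n * a (Suc (Suc n))" by (simp add: mult_ac)
    then show ?case using pos_Suc Suc by simp
  qed
  have "a 0 * r ^ n \<le> a n"
  proof (induction n)
    case (Suc n)
    have "a 0 * r ^ Suc n = r * (a 0 * r ^ n)" by simp
    also have "\<dots> \<le> r * a n" using Suc r_pos by (intro mult_left_mono) auto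
    also have "\<dots> \<le> a (Suc n)" using pos_and_ratio by blast
    finally show ?case .
  qed simp
  then show ?thesis by (simp add: r_def)
qed

lemma log_convex_ratio_le:
  fixes a :: "nat \<Rightarrow> real"
  assumes nonneg: "\<And>n. 0 \<le> a n" and log_convex: "\<And>n. (a (Suc n))\<^sup>2 \<le> a n * a (Suc (Suc n))"
    and decay: "\<And>n. a n \<le> C * q ^ n" and q_pos: "0 < q"
  shows "a 1 \<le> q * a 0"
proof (rule ccontr)
  assume "\<not> a 1 \<le> q * a 0"
  then have q_less_ratio: "q * a 0 < a 1" by simp
  then have a_1_pos: "0 < a 1" using nonneg[of 0] q_pos
    by (meson le_less_trans mult_nonneg_nonneg less_imp_le)
  then have a_0_pos: "0 < a 0" using nonneg[of 0] log_convex[of 0] by (cases "a 0 = 0") auto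
  define r where "r = a 1 / a 0"
  have "1 < r / q" using q_less_ratio a_0_pos q_pos by (simp add: r_def field_simps)
  then obtain n where power_n_gt: "C / a 0 < (r / q) ^ n" using real_arch_pow by blast
  have "a 0 * r ^ n \<le> C * q ^ n"
    using log_convex_geometric_le[OF log_convex a_0_pos a_1_pos] decay unfolding r_def
    by (rule order_trans)
  then have "(r / q) ^ n \<le> C / a 0" using q_pos a_0_pos by (simp add: power_divide field_simps)
  with power_n_gt show False by simp
qed

context haar_unitary
begin

definition orth_mean :: "('a ^ 'n \<Rightarrow> real) \<Rightarrow> 'a ^ 'n \<Rightarrow> real" where
  "orth_mean \<phi> x = (\<integral>z. \<phi> (orth_dir x z) \<partial>\<sigma>)"

lemma bounded_borel_orth_dir: "bounded_borel \<phi> \<Longrightarrow> bounded_borel (\<lambda>z. \<phi> (orth_dir x z))"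
  by (rule bounded_borel_compose) measurable

lemma bounded_borel_orth_mean:
  assumes "bounded_borel \<phi>" shows "bounded_borel (orth_mean \<phi>)"
proof -
  have [measurable]: "\<phi> \<in> borel_measurable borel" using assms by (rule bounded_borel_measurable)
  obtain C where phi_le: "\<And>x. \<bar>\<phi> x\<bar> \<le> C" using bounded_borelE[OF assms] by blast
  have "\<bar>orth_mean \<phi> x\<bar> \<le> C" for x
    unfolding orth_mean_def
    by (intro sphere.abs_expectation_le sphere.integrable_bounded_borel bounded_borel_orth_dir
        assms)
       (simp add: phi_le)
  moreover have "orth_mean \<phi> \<in> borel_measurable borel"
    unfolding orth_mean_def by measurable
  ultimately show ?thesis by (intro bounded_borelI)
qed

lemma bounded_borel_orth_mean_pow: "bounded_borel \<phi> \<Longrightarrow> bounded_borel ((orth_mean ^^ n) \<phi>)"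
  by (induction n) (auto intro: bounded_borel_orth_mean)

lemma abs_orth_mean_diff_le:
  assumes "bounded_borel \<phi>" "bounded_borel \<psi>"
    and diff_le: "\<And>y. norm y = 1 \<Longrightarrow> \<bar>\<phi> y - \<psi> y\<bar> \<le> e" and "norm x = 1"
  shows "\<bar>orth_mean \<phi> x - orth_mean \<psi> x\<bar> \<le> e"
proof -
  have "orth_mean \<phi> x - orth_mean \<psi> x = (\<integral>z. \<phi> (orth_dir x z) - \<psi> (orth_dir x z) \<partial>\<sigma>)"
    by (simp add: orth_mean_def assms(1,2) sphere.integrable_bounded_borel bounded_borel_orth_dir)
  also have "\<bar>\<dots>\<bar> \<le> e"
  proof (rule sphere.abs_expectation_le)
    show "AE z in \<sigma>. \<bar>\<phi> (orth_dir x z) - \<psi> (orth_dir x z)\<bar> \<le> e"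
      using AE_rejection_neq_0[of x] by eventually_elim (simp add: diff_le norm_orth_dir)
  qed (intro sphere.integrable_bounded_borel bounded_borel_diff bounded_borel_orth_dir assms(1,2))
  finally show ?thesis .
qed

lemma orth_mean_cong:
  assumes "bounded_borel \<phi>" "bounded_borel \<psi>" "\<And>y. norm y = 1 \<Longrightarrow> \<phi> y = \<psi> y" "norm x = 1"
  shows "orth_mean \<phi> x = orth_mean \<psi> x"
  using abs_orth_mean_diff_le[OF assms(1,2) _ assms(4), of 0] assms(3) by simp

lemma orth_mean_phase: "norm c = 1 \<Longrightarrow> orth_mean \<phi> (c *s x) = orth_mean \<phi> x"
  by (simp add: orth_mean_def orth_dir_phase)

lemma continuous_on_orth_mean:
  assumes bounded_phi: "bounded_borel \<phi>" and continuous_phi: "continuous_on UNIV \<phi>"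
  shows "continuous_on UNIV (orth_mean \<phi>)"
  unfolding continuous_on_sequentially comp_def
proof (intro allI ballI impI)
  fix X and x :: "'a ^ 'n"
  assume "(\<forall>n. X n \<in> UNIV) \<and> X \<longlonglongrightarrow> x"
  then have X_tendsto: "X \<longlonglongrightarrow> x" by simp
  have [measurable]: "\<phi> \<in> borel_measurable borel"
    using bounded_phi by (rule bounded_borel_measurable)
  obtain C where phi_le: "\<And>x. \<bar>\<phi> x\<bar> \<le> C" using bounded_borelE[OF bounded_phi] by blast
  show "(\<lambda>n. orth_mean \<phi> (X n)) \<longlonglongrightarrow> orth_mean \<phi> x"
    unfolding orth_mean_def
  proof (rule integral_dominated_convergence[where w = "\<lambda>_. C"])
    show "AE z in \<sigma>. (\<lambda>n. \<phi> (orth_dir (X n) z)) \<longlonglongrightarrow> \<phi> (orth_dir x z)"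
      using AE_rejection_neq_0[of x]
    proof eventually_elim
      case (elim z)
      have "continuous_on UNIV (\<lambda>x. rejection x z)" by (intro continuous_intros)
      then have "(\<lambda>n. rejection (X n) z) \<longlonglongrightarrow> rejection x z"
        using X_tendsto by (rule continuous_on_tendsto_compose) auto
      then have "(\<lambda>n. orth_dir (X n) z) \<longlonglongrightarrow> orth_dir x z"
        unfolding orth_dir_def using elim by (intro tendsto_sgn)
      with continuous_phi show ?case by (rule continuous_on_tendsto_compose) auto
    qed
  qed (use phi_le in auto)
qed

lemma integral_haar_pair_mult:
  assumes bounded_phi: "bounded_borel \<phi>" and bounded_psi: "bounded_borel \<psi>"
    and orthonormal_xy: "orthonormal_pair x y"
  shows "(\<integral>R. \<phi> (R *v x) * \<psi> (R *v y) \<partial>\<mu>) = (\<integral>u. \<phi> u * orth_mean \<psi> u \<partial>\<sigma>)"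
proof -
  have [measurable]: "\<phi> \<in> borel_measurable borel" "\<psi> \<in> borel_measurable borel"
    using bounded_phi bounded_psi by (auto intro: bounded_borel_measurable)
  obtain C where phi_le: "\<And>x. \<bar>\<phi> x\<bar> \<le> C" "0 \<le> C" using bounded_borelE[OF bounded_phi] by blast
  obtain D where psi_le: "\<And>x. \<bar>\<psi> x\<bar> \<le> D" using bounded_borelE[OF bounded_psi] by blast
  let ?F = "\<lambda>(u, v). \<phi> u * \<psi> v"
  have "(\<integral>R. \<phi> (R *v x) * \<psi> (R *v y) \<partial>\<mu>) =
      integral\<^sup>L (distr \<mu> (borel \<Otimes>\<^sub>M borel) (\<lambda>R. (R *v x, R *v y))) ?F"
    by (subst integral_distr) simp_all
  also have "\<dots> = (\<integral>(u, z). \<phi> u * \<psi> (orth_dir u z) \<partial>(\<sigma> \<Otimes>\<^sub>M \<sigma>))"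
    unfolding distr_haar_pair[OF orthonormal_xy]
    by (subst integral_distr) (simp_all add: case_prod_unfold)
  also have "\<dots> = (\<integral>u. (\<integral>z. \<phi> u * \<psi> (orth_dir u z) \<partial>\<sigma>) \<partial>\<sigma>)"
    by (rule sphere_sphere.integral_fst[symmetric],
        rule sphere_sphere.integrable_const_bound[of _ "C * D"])
       (auto simp: case_prod_unfold abs_mult intro!: mult_mono phi_le psi_le)
  finally show ?thesis by (simp add: orth_mean_def)
qed

lemma orth_mean_self_adjoint:
  assumes "bounded_borel \<phi>" "bounded_borel \<psi>"
  shows "(\<integral>x. \<phi> x * orth_mean \<psi> x \<partial>\<sigma>) = (\<integral>x. orth_mean \<phi> x * \<psi> x \<partial>\<sigma>)"
proof -
  obtain x y :: "'a ^ 'n" where orthonormal_xy: "orthonormal_pair x y"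
    using ex_orthonormal_pair[OF norm_axis_one] by blast
  have "(\<integral>x. \<phi> x * orth_mean \<psi> x \<partial>\<sigma>) = (\<integral>R. \<phi> (R *v x) * \<psi> (R *v y) \<partial>\<mu>)"
    by (rule integral_haar_pair_mult[OF assms orthonormal_xy, symmetric])
  also have "\<dots> = (\<integral>R. \<psi> (R *v y) * \<phi> (R *v x) \<partial>\<mu>)"
    by (simp add: mult.commute)
  also have "\<dots> = (\<integral>x. \<psi> x * orth_mean \<phi> x \<partial>\<sigma>)"
    by (rule integral_haar_pair_mult[OF assms(2,1) orthonormal_pair_commute[OF orthonormal_xy]])
  finally show ?thesis by (simp add: mult.commute)
qed

lemma integral_orth_mean:
  assumes "bounded_borel \<phi>" shows "(\<integral>x. orth_mean \<phi> x \<partial>\<sigma>) = (\<integral>x. \<phi> x \<partial>\<sigma>)"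
  using orth_mean_self_adjoint[OF bounded_borel_const[of 1] assms] by (simp add: orth_mean_def)

text \<open>By self-adjointness \<open>n \<mapsto> \<parallel>orth_mean\<^sup>n \<phi>\<parallel>\<^sup>2\<close> is log-convex, so its first ratio is at most its
  exponential rate of decay, whatever the constant \<open>C\<close>.\<close>

lemma orth_mean_contraction_if_decay:
  assumes bounded_phi: "bounded_borel \<phi>" and q_pos: "0 < q"
    and decay: "\<And>n x. norm x = 1 \<Longrightarrow> \<bar>(orth_mean ^^ n) \<phi> x\<bar> \<le> C * q ^ n"
  shows "(\<integral>x. (orth_mean \<phi> x)\<^sup>2 \<partial>\<sigma>) \<le> q\<^sup>2 * (\<integral>x. (\<phi> x)\<^sup>2 \<partial>\<sigma>)"
proof -
  define a where "a n = (\<integral>x. ((orth_mean ^^ n) \<phi> x)\<^sup>2 \<partial>\<sigma>)" for n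
  have bounded: "bounded_borel ((orth_mean ^^ n) \<phi>)" for n
    by (rule bounded_borel_orth_mean_pow[OF bounded_phi])
  note square_integrable = sphere.square_integrable_bounded_borel[OF bounded]
  have "a 1 \<le> q\<^sup>2 * a 0"
  proof (rule log_convex_ratio_le)
    fix n
    show "0 \<le> a n" by (simp add: a_def)
    have "a (Suc n) = (\<integral>x. orth_mean ((orth_mean ^^ n) \<phi>) x * (orth_mean ^^ Suc n) \<phi> x \<partial>\<sigma>)"
      by (simp add: a_def power2_eq_square)
    also have "\<dots> = (\<integral>x. (orth_mean ^^ n) \<phi> x * (orth_mean ^^ Suc (Suc n)) \<phi> x \<partial>\<sigma>)"
      using orth_mean_self_adjoint[OF bounded bounded, of n "Suc n"] by simp
    finally have a_Suc: "a (Suc n)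
        = (\<integral>x. (orth_mean ^^ n) \<phi> x * (orth_mean ^^ Suc (Suc n)) \<phi> x \<partial>\<sigma>)" .
    show "(a (Suc n))\<^sup>2 \<le> a n * a (Suc (Suc n))"
      unfolding a_Suc unfolding a_def by (rule Cauchy_Schwarz_integral) (rule square_integrable)+
    have "\<bar>a n\<bar> \<le> (C * q ^ n)\<^sup>2"
      unfolding a_def
    proof (rule sphere.abs_expectation_le)
      show "integrable \<sigma> (\<lambda>x. ((orth_mean ^^ n) \<phi> x)\<^sup>2)"
        by (rule square_integrable_integrable_power2[OF square_integrable])
      show "AE x in \<sigma>. \<bar>((orth_mean ^^ n) \<phi> x)\<^sup>2\<bar> \<le> (C * q ^ n)\<^sup>2"
        using AE_sphere_law_norm
      proof eventually_elim
        case (elim x)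
        have "\<bar>(orth_mean ^^ n) \<phi> x\<bar>\<^sup>2 \<le> (C * q ^ n)\<^sup>2"
          by (rule power_mono) (use decay elim in auto)
        then show ?case by simp
      qed
    qed
    then show "a n \<le> C\<^sup>2 * (q\<^sup>2) ^ n"
      by (simp add: power_mult_distrib power_even_eq[symmetric] flip: power_mult)
         (simp add: mult.commute)
  qed (use q_pos in simp)
  then show ?thesis by (simp add: a_def)
qed

end

section \<open>Zonal functions\<close>

definition rescale_mean :: "real measure \<Rightarrow> (real \<Rightarrow> real) \<Rightarrow> real \<Rightarrow> real" where
  "rescale_mean N f s = (\<integral>t. f ((1 - s) * t) \<partial>N)"

context
  fixes N :: "real measure"
  assumes prob_space_N: "prob_space N" and sets_N [measurable_cong]: "sets N = sets borel"
begin

interpretation prob_space N by (fact prob_space_N)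
interpretation finite_euclidean_measure N by standard (fact sets_N)

lemma bounded_borel_rescale_mean:
  assumes "bounded_borel f" shows "bounded_borel (rescale_mean N f)"
proof -
  have [measurable]: "f \<in> borel_measurable borel" using assms by (rule bounded_borel_measurable)
  obtain C where f_le: "\<And>x. \<bar>f x\<bar> \<le> C" using bounded_borelE[OF assms] by blast
  have "\<bar>rescale_mean N f s\<bar> \<le> C" for s
    unfolding rescale_mean_def
    by (intro abs_expectation_le integrable_bounded_borel bounded_borel_compose[OF assms])
       (simp_all add: f_le)
  moreover have "rescale_mean N f \<in> borel_measurable borel"
    unfolding rescale_mean_def by measurable
  ultimately show ?thesis by (intro bounded_borelI)
qed

lemma lipschitz_on_rescale_mean:
  assumes bounded_f: "bounded_borel f" and lipschitz_f: "L-lipschitz_on UNIV f"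
    and integrable_id: "integrable N (\<lambda>t. t)"
  shows "(L * (\<integral>t. \<bar>t\<bar> \<partial>N))-lipschitz_on UNIV (rescale_mean N f)"
proof (rule lipschitz_onI)
  have integrable: "integrable N (\<lambda>t. f ((1 - s) * t))" for s
    by (intro integrable_bounded_borel bounded_borel_compose[OF bounded_f]) measurable
  fix s s'
  have "dist (rescale_mean N f s) (rescale_mean N f s')
      = \<bar>\<integral>t. f ((1 - s) * t) - f ((1 - s') * t) \<partial>N\<bar>"
    by (simp add: rescale_mean_def dist_real_def integrable)
  also have "\<dots> \<le> (\<integral>t. \<bar>f ((1 - s) * t) - f ((1 - s') * t)\<bar> \<partial>N)"
    by (rule integral_abs_bound)
  also have "\<dots> \<le> (\<integral>t. L * dist s s' * \<bar>t\<bar> \<partial>N)"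
  proof (rule integral_mono)
    fix t
    have "(1 - s) * t - (1 - s') * t = (s' - s) * t" by (simp add: algebra_simps)
    then show "\<bar>f ((1 - s) * t) - f ((1 - s') * t)\<bar> \<le> L * dist s s' * \<bar>t\<bar>"
      using lipschitz_onD[OF lipschitz_f, of "(1 - s) * t" "(1 - s') * t"]
      by (simp add: dist_real_def abs_mult abs_minus_commute)
  qed (use integrable integrable_id in auto)
  finally show "dist (rescale_mean N f s) (rescale_mean N f s') \<le> L * (\<integral>t. \<bar>t\<bar> \<partial>N) * dist s s'"
    by (simp add: mult_ac)
qed (use lipschitz_on_nonneg[OF lipschitz_f] in simp)

lemma bounded_borel_rescale_mean_pow: "bounded_borel f \<Longrightarrow> bounded_borel ((rescale_mean N ^^ n) f)"
  by (induction n) (auto intro: bounded_borel_rescale_mean)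

lemma lipschitz_on_rescale_mean_pow:
  assumes bounded_f: "bounded_borel f" and lipschitz_f: "L-lipschitz_on UNIV f"
    and integrable_id: "integrable N (\<lambda>t. t)"
  shows "(L * (\<integral>t. \<bar>t\<bar> \<partial>N) ^ n)-lipschitz_on UNIV ((rescale_mean N ^^ n) f)"
proof (induction n)
  case (Suc n)
  then show ?case
    using lipschitz_on_rescale_mean[OF bounded_borel_rescale_mean_pow[OF bounded_f] Suc
        integrable_id]
    by (simp add: mult_ac)
qed (use lipschitz_f in simp)

end

context haar_unitary
begin

definition kappa :: real where
  "kappa = 1 / (real CARD('n) - 1)"

lemma kappa_pos: "0 < kappa"
  using card_ge_2 by (simp add: kappa_def)

definition overlap_law :: "'a ^ 'n \<Rightarrow> 'a ^ 'n \<Rightarrow> real measure" where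
  "overlap_law x v = distr \<sigma> borel (\<lambda>z. overlap v (orth_dir x z))"

lemma sets_overlap_law [simp, measurable_cong]: "sets (overlap_law x v) = sets borel"
  by (simp add: overlap_law_def)

lemma prob_space_overlap_law: "prob_space (overlap_law x v)"
  unfolding overlap_law_def by (rule sphere.prob_space_distr) measurable

lemma overlap_law_cong:
  assumes "orthonormal_pair x v" "orthonormal_pair x' v'"
  shows "overlap_law x v = overlap_law x' v'"
proof -
  obtain A where unitary_A: "A \<in> unitaries" "A *v x = x'" "A *v v = v'"
    using ex_unitary_orthonormal_pair[OF assms] .
  have "overlap_law x' v' = distr (distr \<sigma> borel ((*v) A)) borel (\<lambda>z. overlap v' (orth_dir x' z))"
    using unitary_A(1) by (simp add: overlap_law_def distr_sphere_law_orthogonal_transformation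
        orthogonal_transformation_unitary)
  also have "\<dots> = overlap_law x v"
    unfolding overlap_law_def
    by (subst distr_distr)
       (simp_all add: comp_def orth_dir_unitary unitary_A(1) flip: unitary_A(2,3))
  finally show ?thesis ..
qed

lemma integral_overlap_law:
  fixes F :: "real \<Rightarrow> real"
  assumes "F \<in> borel_measurable borel"
  shows "(\<integral>t. F t \<partial>overlap_law x v) = (\<integral>z. F (overlap v (orth_dir x z)) \<partial>\<sigma>)"
  unfolding overlap_law_def by (rule integral_distr) (use assms in measurable)

lemma bounded_borel_overlap_orth_dir:
  "norm v = 1 \<Longrightarrow> bounded_borel (\<lambda>z. overlap v (orth_dir x z))"
  by (rule bounded_borelI[of _ 1]) (auto simp: overlap_orth_dir_le_1)

lemma integrable_overlap_law: "norm v = 1 \<Longrightarrow> integrable (overlap_law x v) (\<lambda>t. t)"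
  unfolding overlap_law_def
  by (subst integrable_distr_eq)
     (auto intro: sphere.integrable_bounded_borel bounded_borel_overlap_orth_dir)

text \<open>The overlaps of a random unit vector orthogonal to \<open>x\<close> with the other \<open>CARD('n) - 1\<close> vectors
  of an orthonormal basis through \<open>x\<close> add up to 1.\<close>

lemma expectation_overlap_law:
  assumes orthonormal_xv: "orthonormal_pair x v"
  shows "(\<integral>t. \<bar>t\<bar> \<partial>overlap_law x v) = kappa"
proof -
  let ?m = "\<integral>t. \<bar>t\<bar> \<partial>overlap_law x v"
  obtain i :: 'n where True by simp
  let ?x = "axis i (1::'a)"
  have integral_axis: "(\<integral>z. overlap (axis j 1) (orth_dir ?x z) \<partial>\<sigma>) = ?m" if "j \<noteq> i" for j
  proof -
    have "orthonormal_pair ?x (axis j 1)" using that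
      by (simp add: orthonormal_pair_def) (simp add: axis_def)
    then show ?thesis
      using integral_overlap_law[of abs ?x "axis j 1"] overlap_law_cong[OF orthonormal_xv] by simp
  qed
  have "(real CARD('n) - 1) * ?m = (\<Sum>j\<in>UNIV - {i}. (\<integral>z. overlap (axis j 1) (orth_dir ?x z) \<partial>\<sigma>))"
    using card_ge_2 by (simp add: integral_axis card_Diff_singleton of_nat_diff)
  also have "\<dots> = (\<integral>z. (\<Sum>j\<in>UNIV - {i}. overlap (axis j 1) (orth_dir ?x z)) \<partial>\<sigma>)"
    by (rule Bochner_Integration.integral_sum[symmetric])
       (intro sphere.integrable_bounded_borel bounded_borel_overlap_orth_dir norm_axis_one)
  also have "\<dots> = (\<integral>z. 1 \<partial>\<sigma>)"
  proof (rule integral_cong_AE)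
    show "AE z in \<sigma>. (\<Sum>j\<in>UNIV - {i}. overlap (axis j 1) (orth_dir ?x z)) = 1"
      using AE_rejection_neq_0[of ?x]
    proof eventually_elim
      case (elim z)
      have "overlap ?x (orth_dir ?x z) = 0"
        by (simp only: overlap_def herm_orth_dir norm_axis_one) simp
      then have "(\<Sum>j\<in>UNIV - {i}. overlap (axis j 1) (orth_dir ?x z)) = (norm (orth_dir ?x z))\<^sup>2"
        unfolding sum_overlap_axis[symmetric] by (subst (2) sum.remove[of _ i]) auto
      then show ?case using norm_orth_dir[OF elim] by simp
    qed
  qed measurable
  finally show ?thesis using card_ge_2 by (simp add: kappa_def field_simps)
qed

lemma integral_zonal_orth_dir:
  assumes bounded_f: "bounded_borel f" and orthonormal_xv: "orthonormal_pair x v"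
    and norm_a: "norm a = 1" and norm_y: "norm y = 1"
  shows "(\<integral>z. f (overlap a (orth_dir y z)) \<partial>\<sigma>) = rescale_mean (overlap_law x v) f (overlap a y)"
proof (cases "rejection y a = 0")
  case True
  interpret prob_space "overlap_law x v" by (rule prob_space_overlap_law)
  have "overlap a y = 1" using norm_rejection[OF norm_y, of a] norm_a True by simp
  then show ?thesis
    using prob_space by (simp add: overlap_orth_dir_eq[OF norm_y norm_a] rescale_mean_def)
next
  case False
  have [measurable]: "f \<in> borel_measurable borel"
    using bounded_f by (rule bounded_borel_measurable)
  have "(\<integral>z. f (overlap a (orth_dir y z)) \<partial>\<sigma>)
      = (\<integral>t. f ((1 - overlap a y) * t) \<partial>overlap_law y (orth_dir y a))"
    unfolding overlap_orth_dir_eq[OF norm_y norm_a]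
    by (rule integral_overlap_law[symmetric]) measurable
  also have "overlap_law y (orth_dir y a) = overlap_law x v"
    by (rule overlap_law_cong[OF orthonormal_pair_orth_dir[OF norm_y False] orthonormal_xv])
  finally show ?thesis by (simp add: rescale_mean_def)
qed

definition zonal_mix :: "(real \<Rightarrow> real) \<Rightarrow> ('a ^ 'n \<Rightarrow> real) \<Rightarrow> 'a ^ 'n \<Rightarrow> real" where
  "zonal_mix f \<phi> x = (\<integral>a. f (overlap a x) * \<phi> a \<partial>\<sigma>)"

lemma bounded_borel_zonal: "bounded_borel f \<Longrightarrow> bounded_borel (\<lambda>a. f (overlap a x))"
  by (rule bounded_borel_compose) measurable

lemma bounded_borel_zonal_mix:
  assumes bounded_f: "bounded_borel f" and bounded_phi: "bounded_borel \<phi>"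
  shows "bounded_borel (zonal_mix f \<phi>)"
proof -
  have [measurable]: "f \<in> borel_measurable borel" "\<phi> \<in> borel_measurable borel"
    using bounded_f bounded_phi by (auto intro: bounded_borel_measurable)
  obtain C where f_le: "\<And>x. \<bar>f x\<bar> \<le> C" "0 \<le> C" using bounded_borelE[OF bounded_f] by blast
  obtain D where phi_le: "\<And>x. \<bar>\<phi> x\<bar> \<le> D" using bounded_borelE[OF bounded_phi] by blast
  have "\<bar>zonal_mix f \<phi> x\<bar> \<le> C * D" for x
    unfolding zonal_mix_def
    by (intro sphere.abs_expectation_le sphere.integrable_bounded_borel bounded_borel_mult
        bounded_borel_zonal bounded_f bounded_phi)
       (auto simp: abs_mult intro!: mult_mono f_le phi_le)
  moreover have "zonal_mix f \<phi> \<in> borel_measurable borel"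
    unfolding zonal_mix_def by measurable
  ultimately show ?thesis by (intro bounded_borelI)
qed

lemma orth_mean_zonal_mix:
  assumes bounded_f: "bounded_borel f" and bounded_phi: "bounded_borel \<phi>"
    and orthonormal_xv: "orthonormal_pair x v" and norm_y: "norm y = 1"
  shows "orth_mean (zonal_mix f \<phi>) y = zonal_mix (rescale_mean (overlap_law x v) f) \<phi> y"
proof -
  have "bounded_borel (rescale_mean (overlap_law x v) f)"
    by (intro bounded_borel_rescale_mean prob_space_overlap_law bounded_f) simp
  then have [measurable]: "f \<in> borel_measurable borel" "\<phi> \<in> borel_measurable borel"
      "rescale_mean (overlap_law x v) f \<in> borel_measurable borel"
    using bounded_f bounded_phi by (auto intro: bounded_borel_measurable)
  obtain C where f_le: "\<And>x. \<bar>f x\<bar> \<le> C" "0 \<le> C" using bounded_borelE[OF bounded_f] by blast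
  obtain D where phi_le: "\<And>x. \<bar>\<phi> x\<bar> \<le> D" using bounded_borelE[OF bounded_phi] by blast
  have "orth_mean (zonal_mix f \<phi>) y = (\<integral>z. (\<integral>a. f (overlap a (orth_dir y z)) * \<phi> a \<partial>\<sigma>) \<partial>\<sigma>)"
    by (simp add: orth_mean_def zonal_mix_def)
  also have "\<dots> = (\<integral>a. (\<integral>z. f (overlap a (orth_dir y z)) * \<phi> a \<partial>\<sigma>) \<partial>\<sigma>)"
    by (rule sphere_sphere.Fubini_integral,
        rule sphere_sphere.integrable_const_bound[of _ "C * D"])
       (auto simp: case_prod_unfold abs_mult intro!: mult_mono f_le phi_le)
  also have "\<dots> = zonal_mix (rescale_mean (overlap_law x v) f) \<phi> y"
    unfolding zonal_mix_def
  proof (rule integral_cong_AE)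
    show "AE a in \<sigma>. (\<integral>z. f (overlap a (orth_dir y z)) * \<phi> a \<partial>\<sigma>)
        = rescale_mean (overlap_law x v) f (overlap a y) * \<phi> a"
      using AE_sphere_law_norm
      by eventually_elim (simp add: integral_zonal_orth_dir[OF bounded_f orthonormal_xv _ norm_y])
  qed measurable
  finally show ?thesis .
qed

lemma orth_mean_pow_zonal_mix:
  assumes bounded_f: "bounded_borel f" and bounded_phi: "bounded_borel \<phi>"
    and orthonormal_xv: "orthonormal_pair x v" and norm_y: "norm y = 1"
  shows "(orth_mean ^^ n) (zonal_mix f \<phi>) y
      = zonal_mix ((rescale_mean (overlap_law x v) ^^ n) f) \<phi> y"
  using norm_y
proof (induction n arbitrary: y)
  case (Suc n)
  let ?f = "(rescale_mean (overlap_law x v) ^^ n) f"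
  have bounded_f_n: "bounded_borel ?f"
    by (intro bounded_borel_rescale_mean_pow prob_space_overlap_law bounded_f) simp
  have "(orth_mean ^^ Suc n) (zonal_mix f \<phi>) y = orth_mean (zonal_mix ?f \<phi>) y"
    using Suc by (auto intro!: orth_mean_cong bounded_borel_orth_mean_pow
        bounded_borel_zonal_mix bounded_f bounded_phi bounded_f_n)
  also have "\<dots> = zonal_mix (rescale_mean (overlap_law x v) ?f) \<phi> y"
    by (rule orth_mean_zonal_mix[OF bounded_f_n bounded_phi orthonormal_xv Suc.prems])
  finally show ?case by simp
qed simp

lemma abs_zonal_mix_le:
  assumes bounded_f: "bounded_borel f" and lipschitz_f: "L-lipschitz_on UNIV f"
    and bounded_phi: "bounded_borel \<phi>" and mean_zero: "(\<integral>x. \<phi> x \<partial>\<sigma>) = 0" and norm_x: "norm x = 1"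
  shows "\<bar>zonal_mix f \<phi> x\<bar> \<le> L * (\<integral>x. \<bar>\<phi> x\<bar> \<partial>\<sigma>)"
proof -
  note bounded = bounded_borel_intros bounded_borel_zonal[OF bounded_f] bounded_phi
  have "zonal_mix f \<phi> x = (\<integral>a. f (overlap a x) * \<phi> a \<partial>\<sigma>) - (\<integral>a. f 0 * \<phi> a \<partial>\<sigma>)"
    by (simp add: zonal_mix_def mean_zero)
  also have "\<dots> = (\<integral>a. (f (overlap a x) - f 0) * \<phi> a \<partial>\<sigma>)"
    unfolding left_diff_distrib
    by (rule Bochner_Integration.integral_diff[symmetric])
       (intro sphere.integrable_bounded_borel bounded)+
  also have "\<bar>\<dots>\<bar> \<le> (\<integral>a. \<bar>(f (overlap a x) - f 0) * \<phi> a\<bar> \<partial>\<sigma>)" by (rule integral_abs_bound)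
  also have "\<dots> \<le> (\<integral>a. L * \<bar>\<phi> a\<bar> \<partial>\<sigma>)"
  proof (rule integral_mono_AE)
    show "AE a in \<sigma>. \<bar>(f (overlap a x) - f 0) * \<phi> a\<bar> \<le> L * \<bar>\<phi> a\<bar>"
      using AE_sphere_law_norm
    proof eventually_elim
      case (elim a)
      have "\<bar>f (overlap a x) - f 0\<bar> \<le> L * overlap a x"
        using lipschitz_onD[OF lipschitz_f, of "overlap a x" 0] by (simp add: dist_real_def)
      also have "\<dots> \<le> L * 1"
        using overlap_le_1[OF norm_x elim] lipschitz_on_nonneg[OF lipschitz_f]
        by (intro mult_left_mono) auto
      finally show ?case by (simp add: abs_mult mult_right_mono)
    qed
  qed (intro sphere.integrable_bounded_borel bounded)+
  finally show ?thesis by simp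
qed

lemma orth_mean_contraction_zonal_mix:
  assumes bounded_f: "bounded_borel f" and lipschitz_f: "L-lipschitz_on UNIV f"
    and bounded_phi: "bounded_borel \<phi>" and mean_zero: "(\<integral>x. \<phi> x \<partial>\<sigma>) = 0"
  shows "(\<integral>x. (orth_mean (zonal_mix f \<phi>) x)\<^sup>2 \<partial>\<sigma>) \<le> kappa\<^sup>2 * (\<integral>x. (zonal_mix f \<phi> x)\<^sup>2 \<partial>\<sigma>)"
proof (rule orth_mean_contraction_if_decay[where C = "L * (\<integral>x. \<bar>\<phi> x\<bar> \<partial>\<sigma>)"])
  show "bounded_borel (zonal_mix f \<phi>)" by (rule bounded_borel_zonal_mix[OF bounded_f bounded_phi])
  show "0 < kappa" by (rule kappa_pos)
  fix n and y :: "'a ^ 'n" assume norm_y: "norm y = 1"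
  obtain v where orthonormal_yv: "orthonormal_pair y v" using ex_orthonormal_pair[OF norm_y] .
  let ?N = "overlap_law y v"
  let ?f = "(rescale_mean ?N ^^ n) f"
  have "integrable ?N (\<lambda>t. t)"
    using orthonormal_yv by (simp add: integrable_overlap_law orthonormal_pair_def)
  then have "(L * kappa ^ n)-lipschitz_on UNIV ?f"
    using lipschitz_on_rescale_mean_pow[OF prob_space_overlap_law sets_overlap_law bounded_f
        lipschitz_f, of y v]
    by (simp add: expectation_overlap_law[OF orthonormal_yv])
  moreover have "bounded_borel ?f"
    by (intro bounded_borel_rescale_mean_pow prob_space_overlap_law bounded_f) simp
  ultimately have "\<bar>zonal_mix ?f \<phi> y\<bar> \<le> L * kappa ^ n * (\<integral>x. \<bar>\<phi> x\<bar> \<partial>\<sigma>)"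
    by (intro abs_zonal_mix_le bounded_phi mean_zero norm_y)
  then show "\<bar>(orth_mean ^^ n) (zonal_mix f \<phi>) y\<bar> \<le> L * (\<integral>x. \<bar>\<phi> x\<bar> \<partial>\<sigma>) * kappa ^ n"
    by (simp add: orth_mean_pow_zonal_mix[OF bounded_f bounded_phi orthonormal_yv norm_y] mult_ac)
qed

section \<open>Zonal approximate identities\<close>

definition phase_invariant :: "('a ^ 'n \<Rightarrow> real) \<Rightarrow> bool" where
  "phase_invariant \<phi> \<longleftrightarrow> (\<forall>c x. norm c = 1 \<longrightarrow> \<phi> (c *s x) = \<phi> x)"

lemma phase_invariant_orth_mean: "phase_invariant (orth_mean \<phi>)"
  by (simp add: phase_invariant_def orth_mean_phase)

lemma phase_invariant_overlap_modulus:
  assumes continuous_phi: "continuous_on (sphere 0 1) \<phi>" and invariant_phi: "phase_invariant \<phi>"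
    and e_pos: "0 < e"
  obtains m where "0 < m"
    "\<And>a x. norm a = 1 \<Longrightarrow> norm x = 1 \<Longrightarrow> m * (1 - overlap a x) < 1 \<Longrightarrow> \<bar>\<phi> a - \<phi> x\<bar> < e"
proof -
  have "uniformly_continuous_on (sphere 0 1) \<phi>"
    by (rule compact_uniformly_continuous[OF continuous_phi compact_sphere])
  then obtain \<delta> where modulus_delta: "0 < \<delta>"
      "\<And>x y. norm x = 1 \<Longrightarrow> norm y = 1 \<Longrightarrow> dist x y < \<delta> \<Longrightarrow> \<bar>\<phi> x - \<phi> y\<bar> < e"
    using e_pos unfolding uniformly_continuous_on_def by (auto simp: dist_real_def)
  define m where "m = 2 / \<delta>\<^sup>2"
  have m_pos: "0 < m" using modulus_delta(1) by (simp add: m_def)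
  have "\<bar>\<phi> a - \<phi> x\<bar> < e"
    if norm_a: "norm a = 1" and norm_x: "norm x = 1"
      and overlap_near_1: "m * (1 - overlap a x) < 1" for a x
  proof -
    obtain c where phase_c: "norm c = 1" "(norm (a - c *s x))\<^sup>2 \<le> 2 * (1 - overlap a x)"
      using ex_phase_norm_diff[OF norm_a norm_x] .
    note phase_c(2)
    also have "2 * (1 - overlap a x) < \<delta>\<^sup>2"
      using overlap_near_1 modulus_delta(1) by (simp add: m_def field_simps)
    finally have "dist a (c *s x) < \<delta>"
      using modulus_delta(1) by (simp add: dist_norm power2_less_imp_less)
    then have "\<bar>\<phi> a - \<phi> (c *s x)\<bar> < e"
      using norm_a norm_x phase_c(1)
      by (intro modulus_delta(2)) (simp_all add: norm_vector_scalar_mult)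
    then show ?thesis using invariant_phi phase_c(1) by (simp add: phase_invariant_def)
  qed
  then show ?thesis using that[OF m_pos] by blast
qed

lemma integral_zonal_cong:
  fixes g :: "real \<Rightarrow> real"
  assumes [measurable]: "g \<in> borel_measurable borel" and "norm x = 1" "norm y = 1"
  shows "(\<integral>a. g (overlap a x) \<partial>\<sigma>) = (\<integral>a. g (overlap a y) \<partial>\<sigma>)"
proof -
  obtain A where unitary_A: "A \<in> unitaries" "A *v x = y"
    using ex_unitary_fixing_complement assms(2,3) by metis
  have "(\<integral>a. g (overlap a y) \<partial>\<sigma>) = (\<integral>a. g (overlap (A *v a) y) \<partial>\<sigma>)"
    by (rule integral_sphere_unitary[OF _ unitary_A(1), symmetric]) measurable
  then show ?thesis by (simp add: unitary_A(1) flip: unitary_A(2))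
qed

text \<open>Finitely many rotated copies of the support of \<open>g (overlap a x)\<close> cover the sphere.\<close>

lemma integral_zonal_pos:
  assumes bounded_g: "bounded_borel g" and continuous_g: "continuous_on UNIV g"
    and nonneg: "\<And>s. 0 \<le> g s" and pos_at_1: "0 < g 1" and norm_x: "norm x = 1"
  shows "0 < (\<integral>a. g (overlap a x) \<partial>\<sigma>)"
proof (rule ccontr)
  assume "\<not> 0 < (\<integral>a. g (overlap a x) \<partial>\<sigma>)"
  moreover have "0 \<le> (\<integral>a. g (overlap a x) \<partial>\<sigma>)" by (simp add: nonneg)
  ultimately have integral_eq_0: "(\<integral>a. g (overlap a y) \<partial>\<sigma>) = 0" if "norm y = 1" for y
    using integral_zonal_cong[OF bounded_borel_measurable[OF bounded_g] norm_x that] by simp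
  define supp where "supp y = {a. 0 < g (overlap a y)}" for y :: "'a ^ 'n"
  have "open (supp y)" for y
    unfolding supp_def
    by (intro open_Collect_less continuous_intros continuous_on_compose2[OF continuous_g]) auto
  moreover have "sphere 0 1 \<subseteq> (\<Union>y\<in>sphere 0 1. supp y)"
    using pos_at_1 by (force simp: supp_def overlap_def)
  ultimately obtain D where finite_cover: "D \<subseteq> sphere 0 1" "finite D" "sphere 0 1 \<subseteq> (\<Union>y\<in>D. supp y)"
    using compactE_image[OF compact_sphere, of "sphere 0 1" supp] by metis
  have "AE a in \<sigma>. g (overlap a y) = 0" if "y \<in> D" for y
  proof -
    have "(\<integral>a. g (overlap a y) \<partial>\<sigma>) = 0" using integral_eq_0[of y] that finite_cover(1) by auto
    then show ?thesis
      by (subst (asm) integral_nonneg_eq_0_iff_AE)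
         (auto intro: nonneg sphere.integrable_bounded_borel bounded_borel_zonal[OF bounded_g])
  qed
  then have "AE a in \<sigma>. \<forall>y\<in>D. g (overlap a y) = 0"
    using finite_cover(2) by (intro AE_finite_allI)
  with AE_sphere_law_norm have "AE a in \<sigma>. False"
  proof eventually_elim
    case (elim a)
    then obtain y where "y \<in> D" "a \<in> supp y" using finite_cover(3) by force
    then show False using elim by (simp add: supp_def)
  qed
  then show False by simp
qed

lemma abs_zonal_mix_diff_le:
  assumes nonneg_bounded_f: "bounded_borel f" "\<And>s. 0 \<le> f s" and bounded_phi: "bounded_borel \<phi>"
    and total_mass: "(\<integral>a. f (overlap a x) \<partial>\<sigma>) = 1"
    and phi_near: "\<And>a. norm a = 1 \<Longrightarrow> f (overlap a x) \<noteq> 0 \<Longrightarrow> \<bar>\<phi> a - \<phi> x\<bar> \<le> e"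
  shows "\<bar>zonal_mix f \<phi> x - \<phi> x\<bar> \<le> e"
proof -
  note bounded = bounded_borel_intros bounded_borel_zonal[OF nonneg_bounded_f(1)] bounded_phi
  have "zonal_mix f \<phi> x - \<phi> x = (\<integral>a. f (overlap a x) * \<phi> a \<partial>\<sigma>) - (\<integral>a. f (overlap a x) * \<phi> x \<partial>\<sigma>)"
    by (simp add: zonal_mix_def total_mass)
  also have "\<dots> = (\<integral>a. f (overlap a x) * (\<phi> a - \<phi> x) \<partial>\<sigma>)"
    unfolding right_diff_distrib
    by (rule Bochner_Integration.integral_diff[symmetric])
       (intro sphere.integrable_bounded_borel bounded)+
  also have "\<bar>\<dots>\<bar> \<le> (\<integral>a. \<bar>f (overlap a x) * (\<phi> a - \<phi> x)\<bar> \<partial>\<sigma>)" by (rule integral_abs_bound)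
  also have "\<dots> \<le> (\<integral>a. f (overlap a x) * e \<partial>\<sigma>)"
  proof (rule integral_mono_AE)
    show "AE a in \<sigma>. \<bar>f (overlap a x) * (\<phi> a - \<phi> x)\<bar> \<le> f (overlap a x) * e"
      using AE_sphere_law_norm
    proof eventually_elim
      case (elim a)
      then show ?case
        using phi_near[OF elim] nonneg_bounded_f(2)
        by (cases "f (overlap a x) = 0") (auto simp: abs_mult mult_left_mono)
    qed
  qed (intro sphere.integrable_bounded_borel bounded)+
  finally show ?thesis by (simp add: total_mass)
qed

lemma lipschitz_on_tent:
  fixes m p :: real
  assumes m_nonneg: "0 \<le> m" shows "m-lipschitz_on UNIV (\<lambda>s. max 0 (1 - m * \<bar>s - p\<bar>))"
proof (rule lipschitz_onI)
  fix s t
  have "\<bar>m * \<bar>s - p\<bar> - m * \<bar>t - p\<bar>\<bar> = m * \<bar>\<bar>s - p\<bar> - \<bar>t - p\<bar>\<bar>"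
    using m_nonneg by (simp add: abs_mult flip: right_diff_distrib)
  also have "\<dots> \<le> m * \<bar>s - t\<bar>" using m_nonneg by (intro mult_left_mono) auto
  finally show "dist (max 0 (1 - m * \<bar>s - p\<bar>)) (max 0 (1 - m * \<bar>t - p\<bar>)) \<le> m * dist s t"
    unfolding dist_real_def by linarith
qed (rule m_nonneg)

lemma ex_zonal_mix_approx:
  assumes bounded_phi: "bounded_borel \<phi>" and continuous_phi: "continuous_on (sphere 0 1) \<phi>"
    and invariant_phi: "phase_invariant \<phi>" and e_pos: "0 < e"
  obtains L f where "bounded_borel f" "L-lipschitz_on UNIV f"
    "\<And>x. norm x = 1 \<Longrightarrow> \<bar>zonal_mix f \<phi> x - \<phi> x\<bar> \<le> e"
proof -
  obtain m where m_pos: "0 < m"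
    and phi_near: "\<And>a x. norm a = 1 \<Longrightarrow> norm x = 1 \<Longrightarrow> m * (1 - overlap a x) < 1 \<Longrightarrow> \<bar>\<phi> a - \<phi> x\<bar> < e"
    using phase_invariant_overlap_modulus[OF continuous_phi invariant_phi e_pos] by blast
  define g where "g s = max 0 (1 - m * \<bar>s - 1\<bar>)" for s :: real
  have lipschitz_g: "m-lipschitz_on UNIV g"
    using lipschitz_on_tent[of m 1] m_pos by (simp add: g_def[abs_def])
  then have continuous_g: "continuous_on UNIV g" by (rule lipschitz_on_continuous_on)
  have g_range: "0 \<le> g s" "g s \<le> 1" for s using m_pos by (auto simp: g_def)
  then have bounded_g: "bounded_borel g"
    by (intro bounded_borelI[of _ 1] borel_measurable_continuous_onI continuous_g) auto
  obtain i :: 'n where True by simp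
  define c where "c = (\<integral>a. g (overlap a (axis i 1)) \<partial>\<sigma>)"
  have c_pos: "0 < c"
    unfolding c_def
    by (rule integral_zonal_pos[OF bounded_g continuous_g g_range(1)]) (simp_all add: g_def)
  define f where "f s = 1 / c * g s" for s
  have bounded_f: "bounded_borel f" unfolding f_def by (intro bounded_borel_intros bounded_g)
  have "(1 / c * m)-lipschitz_on UNIV f"
    using lipschitz_on_cmult_real_nonneg[OF lipschitz_g, of "1 / c"] c_pos by (simp add: f_def)
  moreover have "\<bar>zonal_mix f \<phi> x - \<phi> x\<bar> \<le> e" if norm_x: "norm x = 1" for x
  proof (rule abs_zonal_mix_diff_le[OF bounded_f _ bounded_phi])
    show "0 \<le> f s" for s using g_range c_pos by (simp add: f_def)
    have "(\<integral>a. g (overlap a x) \<partial>\<sigma>) = c"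
      unfolding c_def
      by (rule integral_zonal_cong[OF bounded_borel_measurable[OF bounded_g] norm_x norm_axis_one])
    then show "(\<integral>a. f (overlap a x) \<partial>\<sigma>) = 1" using c_pos by (simp add: f_def)
    fix a assume norm_a: "norm a = 1" and "f (overlap a x) \<noteq> 0"
    then have "m * (1 - overlap a x) < 1"
      using overlap_le_1[OF norm_x norm_a] by (auto simp: f_def g_def max_def split: if_splits)
    then show "\<bar>\<phi> a - \<phi> x\<bar> \<le> e" using phi_near[OF norm_a norm_x] by simp
  qed
  ultimately show ?thesis using that[OF bounded_f] by blast
qed

theorem orth_mean_contraction_phase_invariant:
  assumes bounded_phi: "bounded_borel \<phi>" and continuous_phi: "continuous_on (sphere 0 1) \<phi>"
    and invariant_phi: "phase_invariant \<phi>" and mean_zero: "(\<integral>x. \<phi> x \<partial>\<sigma>) = 0"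
  shows "(\<integral>x. (orth_mean \<phi> x)\<^sup>2 \<partial>\<sigma>) \<le> kappa\<^sup>2 * (\<integral>x. (\<phi> x)\<^sup>2 \<partial>\<sigma>)"
proof -
  have "\<exists>L f. bounded_borel f \<and> L-lipschitz_on UNIV f \<and>
      (\<forall>x. norm x = 1 \<longrightarrow> \<bar>zonal_mix f \<phi> x - \<phi> x\<bar> \<le> inverse (Suc n))" for n
    by (rule ex_zonal_mix_approx[OF bounded_phi continuous_phi invariant_phi,
        of "inverse (Suc n)"]) auto
  then obtain L f where bounded_f: "\<And>n. bounded_borel (f n)"
    and lipschitz_f: "\<And>n. (L n)-lipschitz_on UNIV (f n)"
    and zonal_mix_near: "\<And>n x. norm x = 1 \<Longrightarrow> \<bar>zonal_mix (f n) \<phi> x - \<phi> x\<bar> \<le> inverse (Suc n)"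
    by metis
  note bounded_zonal_mix = bounded_borel_zonal_mix[OF bounded_f bounded_phi]
  have "L2_tendsto \<sigma> (\<lambda>n. zonal_mix (f n) \<phi>) \<phi>"
  proof (rule sphere.L2_tendsto_if_uniform[OF _ _ _ LIMSEQ_inverse_real_of_nat])
    show "AE x in \<sigma>. \<bar>zonal_mix (f n) \<phi> x - \<phi> x\<bar> \<le> inverse (Suc n)" for n
      using AE_sphere_law_norm by eventually_elim (rule zonal_mix_near)
  qed (intro sphere.square_integrable_bounded_borel bounded_zonal_mix bounded_phi)+
  then have norms_tendsto: "(\<lambda>n. kappa\<^sup>2 * (\<integral>x. (zonal_mix (f n) \<phi> x)\<^sup>2 \<partial>\<sigma>))
      \<longlonglongrightarrow> kappa\<^sup>2 * (\<integral>x. (\<phi> x)\<^sup>2 \<partial>\<sigma>)"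
    by (intro tendsto_intros L2_tendsto_integral_power2)
  have "L2_tendsto \<sigma> (\<lambda>n. orth_mean (zonal_mix (f n) \<phi>)) (orth_mean \<phi>)"
  proof (rule sphere.L2_tendsto_if_uniform[OF _ _ _ LIMSEQ_inverse_real_of_nat])
    show "AE x in \<sigma>. \<bar>orth_mean (zonal_mix (f n) \<phi>) x - orth_mean \<phi> x\<bar> \<le> inverse (Suc n)" for n
      using AE_sphere_law_norm
      by eventually_elim
        (rule abs_orth_mean_diff_le[OF bounded_zonal_mix bounded_phi zonal_mix_near])
  qed (intro sphere.square_integrable_bounded_borel bounded_borel_orth_mean bounded_zonal_mix
      bounded_phi)+
  then have "(\<lambda>n. \<integral>x. (orth_mean (zonal_mix (f n) \<phi>) x)\<^sup>2 \<partial>\<sigma>) \<longlonglongrightarrow> (\<integral>x. (orth_mean \<phi> x)\<^sup>2 \<partial>\<sigma>)"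
    by (rule L2_tendsto_integral_power2)
  then show ?thesis
    using norms_tendsto
    by (rule LIMSEQ_le)
       (auto intro: orth_mean_contraction_zonal_mix bounded_f lipschitz_f bounded_phi mean_zero)
qed

section \<open>The correlation bound and concentration\<close>

lemma integral_mult_orth_mean_le:
  assumes bounded_phi: "bounded_borel \<phi>" and continuous_phi: "continuous_on UNIV \<phi>"
    and mean_zero: "(\<integral>x. \<phi> x \<partial>\<sigma>) = 0"
  shows "(\<integral>x. \<phi> x * orth_mean \<phi> x \<partial>\<sigma>) \<le> kappa * (\<integral>x. (\<phi> x)\<^sup>2 \<partial>\<sigma>)"
proof -
  let ?T = "orth_mean \<phi>"
  define a b where "a = (\<integral>x. (\<phi> x)\<^sup>2 \<partial>\<sigma>)" and "b = (\<integral>x. (?T x)\<^sup>2 \<partial>\<sigma>)"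
  have nonneg: "0 \<le> a" "0 \<le> b" by (simp_all add: a_def b_def)
  have bounded_T: "bounded_borel ?T" by (rule bounded_borel_orth_mean[OF bounded_phi])
  note square_integrable = sphere.square_integrable_bounded_borel
  have "b = (\<integral>x. \<phi> x * orth_mean ?T x \<partial>\<sigma>)"
    using orth_mean_self_adjoint[OF bounded_phi bounded_T] by (simp add: b_def power2_eq_square)
  then have "b\<^sup>2 \<le> a * (\<integral>x. (orth_mean ?T x)\<^sup>2 \<partial>\<sigma>)"
    unfolding a_def
    by (simp only:)
       (intro Cauchy_Schwarz_integral square_integrable bounded_borel_orth_mean bounded_phi
           bounded_T)
  also have "\<dots> \<le> a * (kappa\<^sup>2 * b)"
    unfolding b_def
    using continuous_on_subset[OF continuous_on_orth_mean[OF bounded_phi continuous_phi]]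
    by (intro mult_left_mono orth_mean_contraction_phase_invariant bounded_T
        phase_invariant_orth_mean)
       (simp_all add: integral_orth_mean bounded_phi mean_zero nonneg)
  finally have "b * b \<le> (a * kappa\<^sup>2) * b"
    by (simp add: power2_eq_square mult_ac)
  then have b_le: "b \<le> a * kappa\<^sup>2"
    using nonneg by (cases "b = 0") auto
  have "(\<integral>x. \<phi> x * ?T x \<partial>\<sigma>)\<^sup>2 \<le> a * b"
    unfolding a_def b_def
    by (intro Cauchy_Schwarz_integral square_integrable bounded_phi bounded_T)
  also have "\<dots> \<le> a * (a * kappa\<^sup>2)" using b_le nonneg(1) by (rule mult_left_mono)
  also have "\<dots> = (kappa * a)\<^sup>2" by (simp add: power2_eq_square mult_ac)
  finally show ?thesis
    unfolding a_def[symmetric] by (rule power2_le_imp_le) (use nonneg kappa_pos in simp)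
qed

lemma integral_haar_unit_vector:
  fixes F :: "'a ^ 'n \<Rightarrow> real"
  assumes [measurable]: "F \<in> borel_measurable borel" and norm_x: "norm x = 1"
  shows "(\<integral>R. F (R *v x) \<partial>\<mu>) = (\<integral>x. F x \<partial>\<sigma>)"
  by (subst distr_haar_unit_vector[OF norm_x, symmetric]) (simp add: integral_distr)

lemma square_integrable_haar_unit_vector:
  assumes "square_integrable \<sigma> \<psi>" and norm_x: "norm x = 1"
  shows "square_integrable \<mu> (\<lambda>R. \<psi> (R *v x))"
  using assms(1) square_integrable_distr_iff[of "\<lambda>R. R *v x" \<mu> borel \<psi>]
    sphere.square_integrable_borel[OF assms(1)]
  by (simp add: distr_haar_unit_vector[OF norm_x])

theorem correlation_le:
  assumes square_integrable_psi: "square_integrable \<sigma> \<psi>" and mean_zero: "(\<integral>x. \<psi> x \<partial>\<sigma>) = 0"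
    and orthonormal_xy: "orthonormal_pair x y"
  shows "(\<integral>R. \<psi> (R *v x) * \<psi> (R *v y) \<partial>\<mu>) \<le> kappa * (\<integral>x. (\<psi> x)\<^sup>2 \<partial>\<sigma>)"
proof -
  obtain g where approx_g: "L2_tendsto \<sigma> g \<psi>" "\<And>n. continuous_on UNIV (g n)"
      "\<And>n. bounded_borel (g n)"
    using sphere.L2_tendsto_continuous[OF square_integrable_psi] by blast
  define f where "f n x = g n x - (\<integral>x. g n x \<partial>\<sigma>)" for n x
  have f_tendsto: "L2_tendsto \<sigma> f \<psi>"
    unfolding f_def by (rule sphere.L2_tendsto_centered[OF approx_g(1) mean_zero])
  have bounded_f: "bounded_borel (f n)" for n
    unfolding f_def by (intro bounded_borel_intros approx_g)
  have "L2_tendsto \<mu> (\<lambda>n R. f n (R *v u)) (\<lambda>R. \<psi> (R *v u))" if "norm u = 1" for u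
    using f_tendsto L2_tendsto_distr[of "\<lambda>R. R *v u" \<mu> borel f \<psi>]
    by (simp add: distr_haar_unit_vector that)
  then have correlations_tendsto:
      "(\<lambda>n. \<integral>R. f n (R *v x) * f n (R *v y) \<partial>\<mu>) \<longlonglongrightarrow> (\<integral>R. \<psi> (R *v x) * \<psi> (R *v y) \<partial>\<mu>)"
    using orthonormal_xy by (intro L2_tendsto_integral_mult) (simp_all add: orthonormal_pair_def)
  have norms_tendsto: "(\<lambda>n. kappa * (\<integral>x. (f n x)\<^sup>2 \<partial>\<sigma>)) \<longlonglongrightarrow> kappa * (\<integral>x. (\<psi> x)\<^sup>2 \<partial>\<sigma>)"
    by (intro tendsto_intros L2_tendsto_integral_power2 f_tendsto)
  have "(\<integral>R. f n (R *v x) * f n (R *v y) \<partial>\<mu>) \<le> kappa * (\<integral>x. (f n x)\<^sup>2 \<partial>\<sigma>)" for n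
    unfolding integral_haar_pair_mult[OF bounded_f bounded_f orthonormal_xy]
  proof (rule integral_mult_orth_mean_le[OF bounded_f])
    show "continuous_on UNIV (f n)" unfolding f_def by (intro continuous_intros approx_g)
    show "(\<integral>x. f n x \<partial>\<sigma>) = 0"
      unfolding f_def using sphere.integrable_bounded_borel[OF approx_g(3)] by simp
  qed
  then show ?thesis by (intro LIMSEQ_le[OF correlations_tendsto norms_tendsto]) auto
qed

lemma frame_second_moment_le:
  assumes finite_I: "finite I" and orthonormal_b: "orthonormal_family I b"
    and square_integrable_psi: "square_integrable \<sigma> \<psi>" and mean_zero: "(\<integral>x. \<psi> x \<partial>\<sigma>) = 0"
  shows "(\<integral>R. (\<Sum>i\<in>I. \<psi> (R *v b i))\<^sup>2 \<partial>\<mu>)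
    \<le> real (card I) * (1 + (real (card I) - 1) * kappa) * (\<integral>x. (\<psi> x)\<^sup>2 \<partial>\<sigma>)"
proof -
  define V where "V = (\<integral>x. (\<psi> x)\<^sup>2 \<partial>\<sigma>)"
  have [measurable]: "\<psi> \<in> borel_measurable borel" using square_integrable_psi
    by (rule sphere.square_integrable_borel)
  have integrable: "integrable \<mu> (\<lambda>R. \<psi> (R *v b i) * \<psi> (R *v b j))" if "i \<in> I" "j \<in> I" for i j
    by (intro integrable_mult_square_integrable square_integrable_haar_unit_vector
        square_integrable_psi norm_orthonormal_family[OF orthonormal_b] that)
  have correlation_bound: "(\<integral>R. \<psi> (R *v b i) * \<psi> (R *v b j) \<partial>\<mu>)
      \<le> kappa * V + (if i = j then V - kappa * V else 0)"
    if in_I: "i \<in> I" "j \<in> I" for i j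
  proof (cases "i = j")
    case True
    then show ?thesis
      using integral_haar_unit_vector[of "\<lambda>x. (\<psi> x)\<^sup>2" "b j"]
        norm_orthonormal_family[OF orthonormal_b] in_I
      by (simp add: V_def power2_eq_square)
  next
    case False
    from correlation_le[OF square_integrable_psi mean_zero
        orthonormal_pair_orthonormal_family[OF orthonormal_b in_I False]]
    show ?thesis using False by (simp add: V_def)
  qed
  have "(\<integral>R. (\<Sum>i\<in>I. \<psi> (R *v b i))\<^sup>2 \<partial>\<mu>) = (\<integral>R. (\<Sum>i\<in>I. \<Sum>j\<in>I. \<psi> (R *v b i) * \<psi> (R *v b j)) \<partial>\<mu>)"
    by (simp add: power2_eq_square sum_product)
  also have "\<dots> = (\<Sum>i\<in>I. \<Sum>j\<in>I. (\<integral>R. \<psi> (R *v b i) * \<psi> (R *v b j) \<partial>\<mu>))"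
    by (simp add: Bochner_Integration.integral_sum Bochner_Integration.integrable_sum integrable)
  also have "\<dots> \<le> (\<Sum>i\<in>I. \<Sum>j\<in>I. kappa * V + (if i = j then V - kappa * V else 0))"
    by (intro sum_mono correlation_bound)
  also have "\<dots> = real (card I) * (1 + (real (card I) - 1) * kappa) * V"
    using finite_I by (simp add: sum.distrib algebra_simps)
  finally show ?thesis by (simp only: V_def)
qed

theorem frame_concentration:
  assumes card_I: "card I = CARD('n)" and orthonormal_b: "orthonormal_family I b"
    and square_integrable_phi: "square_integrable \<sigma> \<phi>"
    and eps_pos: "0 < \<epsilon>" and delta_pos: "0 < \<delta>" and card_ge: "2 / (\<delta>\<^sup>2 * \<epsilon>) \<le> real (card I)"
  shows "1 - \<epsilon> \<le> measure \<mu> {R. \<bar>(1 / real (card I)) * (\<Sum>i\<in>I. \<phi> (R *v b i)) - sphere.expectation \<phi>\<bar>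
      \<le> \<delta> * sqrt (sphere.variance \<phi>)}"
proof -
  define \<psi> where "\<psi> x = \<phi> x - sphere.expectation \<phi>" for x
  define Z where "Z R = (1 / real (card I)) * (\<Sum>i\<in>I. \<psi> (R *v b i))" for R
  have card_I_ge_2: "2 \<le> real (card I)" using card_ge_2 by (simp add: card_I)
  then have "finite I" using card.infinite[of I] by fastforce
  have square_integrable_psi: "square_integrable \<sigma> \<psi>"
    unfolding \<psi>_def
    by (intro square_integrable_diff square_integrable_phi
        sphere.square_integrable_bounded_borel bounded_borel_const)
  have mean_zero: "(\<integral>x. \<psi> x \<partial>\<sigma>) = 0"
    using sphere.integrable_square_integrable[OF square_integrable_phi] by (simp add: \<psi>_def)
  have square_integrable_Z: "square_integrable \<mu> Z"
    unfolding Z_def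
    by (intro square_integrable_cmult square_integrable_sum square_integrable_haar_unit_vector
        square_integrable_psi norm_orthonormal_family[OF orthonormal_b])
  have "haar.expectation (\<lambda>R. (Z R)\<^sup>2)
      = (1 / real (card I))\<^sup>2 * haar.expectation (\<lambda>R. (\<Sum>i\<in>I. \<psi> (R *v b i))\<^sup>2)"
    unfolding Z_def power_mult_distrib by simp
  also have "\<dots> \<le> (1 / real (card I))\<^sup>2
      * (real (card I) * (1 + (real (card I) - 1) * kappa) * sphere.variance \<phi>)"
    using frame_second_moment_le[OF \<open>finite I\<close> orthonormal_b square_integrable_psi mean_zero]
    by (intro mult_left_mono) (simp_all add: \<psi>_def)
  also have "(real (card I) - 1) * kappa = 1"
    using card_I_ge_2 by (simp add: kappa_def card_I)
  also have "(1 / real (card I))\<^sup>2 * (real (card I) * (1 + 1) * sphere.variance \<phi>)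
      = (2 / real (card I)) * sphere.variance \<phi>"
    using card_I_ge_2 by (simp add: power2_eq_square)
  also have "\<dots> \<le> (\<delta>\<^sup>2 * \<epsilon>) * sphere.variance \<phi>"
    using card_ge card_I_ge_2 eps_pos delta_pos
    by (intro mult_right_mono) (simp_all add: field_simps)
  also have "\<dots> = \<epsilon> * (\<delta> * sqrt (sphere.variance \<phi>))\<^sup>2"
    by (simp add: power_mult_distrib mult_ac)
  finally have "1 - \<epsilon> \<le> haar.prob {R \<in> space \<mu>. \<bar>Z R\<bar> \<le> \<delta> * sqrt (sphere.variance \<phi>)}"
    using eps_pos delta_pos
    by (intro haar.prob_abs_le_ge_if_second_moment_le square_integrable_Z) simp_all
  moreover have "Z R = (1 / real (card I)) * (\<Sum>i\<in>I. \<phi> (R *v b i)) - sphere.expectation \<phi>" for R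
    using card_I_ge_2 by (simp add: Z_def \<psi>_def sum_subtractf right_diff_distrib)
  ultimately show ?thesis by simp
qed

end

section \<open>Transfer to the orthogonal and the unitary group\<close>

lemma ex_borel_extension_sphere:
  fixes \<phi> :: "'a::euclidean_space \<Rightarrow> real"
  assumes "\<phi> \<in> borel_measurable uniform_sphere"
  obtains \<phi>' where "\<phi>' \<in> borel_measurable borel" "\<And>x. norm x = 1 \<Longrightarrow> \<phi>' x = \<phi> x"
proof
  show "(\<lambda>x. indicator (sphere 0 1) x *\<^sub>R \<phi> x) \<in> borel_measurable borel"
    using assms unfolding measurable_cong_sets[OF sets_uniform_sphere refl]
    by (subst (asm) borel_measurable_restrict_space_iff) auto
qed simp

lemma integral_sphere_law_eq:
  fixes f g :: "'a::euclidean_space \<Rightarrow> real"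
  assumes [measurable]: "f \<in> borel_measurable borel" and eq_on_sphere: "\<And>x. norm x = 1 \<Longrightarrow> f x = g x"
  shows "(\<integral>x. f x \<partial>sphere_law) = (\<integral>x. g x \<partial>uniform_sphere)"
  unfolding sphere_law_def
  by (subst integral_distr) (auto intro!: Bochner_Integration.integral_cong simp: eq_on_sphere)

lemma integrable_sphere_law_iff:
  fixes f g :: "'a::euclidean_space \<Rightarrow> real"
  assumes [measurable]: "f \<in> borel_measurable borel" and eq_on_sphere: "\<And>x. norm x = 1 \<Longrightarrow> f x = g x"
  shows "integrable sphere_law f \<longleftrightarrow> integrable uniform_sphere g"
  unfolding sphere_law_def
  by (subst integrable_distr_eq)
     (auto intro!: Bochner_Integration.integrable_cong simp: eq_on_sphere)

context conj_field
begin

context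
  fixes uG :: "('a ^ 'n ^ 'n) measure"
  assumes haar: "normalized_haar unitaries uG"
begin

lemma sets_normalized_haar: "sets uG = sets (restrict_space borel unitaries)"
  using haar by (simp add: normalized_haar_def)

lemma space_normalized_haar: "space uG = unitaries"
  using sets_eq_imp_space_eq[OF sets_normalized_haar] by (simp add: space_restrict_space)

lemma measurable_ident_normalized_haar: "(\<lambda>x. x) \<in> uG \<rightarrow>\<^sub>M borel"
  by (simp add: measurable_cong_sets[OF sets_normalized_haar refl] measurable_restrict_space1)

lemma emeasure_normalized_haar_left:
  assumes unitary_g: "g \<in> unitaries" and borel_A [measurable]: "A \<in> sets borel"
  shows "emeasure uG {h \<in> unitaries. g ** h \<in> A} = emeasure uG (A \<inter> unitaries)"
proof -
  define B where "B = {h \<in> unitaries. g ** h \<in> A}"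
  have [measurable]: "(unitaries :: ('a ^ 'n ^ 'n) set) \<in> sets borel"
    by (rule borel_closed[OF closed_unitaries])
  have "B \<in> sets borel" unfolding B_def by measurable
  then have sets_B: "B \<in> sets uG"
    unfolding sets_normalized_haar by (auto simp: sets_restrict_space_iff B_def)
  have image: "(\<lambda>h. g ** h) ` B = A \<inter> unitaries"
  proof (intro equalityI subsetI)
    fix k assume "k \<in> A \<inter> unitaries"
    moreover have "k = g ** (adjoint_matrix g ** k)"
      using unitary_g by (simp add: matrix_mul_assoc unitaries_def)
    ultimately show "k \<in> (\<lambda>h. g ** h) ` B"
      using mult_unitary[OF adjoint_matrix_unitary[OF unitary_g]]
      by (intro image_eqI[of _ _ "adjoint_matrix g ** k"]) (auto simp: B_def)
  qed (use mult_unitary[OF unitary_g] in \<open>auto simp: B_def\<close>)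
  have "emeasure uG ((\<lambda>h. g ** h) ` B) = emeasure uG B"
    using haar unitary_g sets_B by (simp add: normalized_haar_def)
  then show ?thesis by (simp only: image) (simp only: B_def)
qed

lemma haar_unitary_distr_ident:
  assumes "2 \<le> CARD('n)" shows "haar_unitary star (distr uG borel (\<lambda>x. x))"
proof (intro haar_unitary.intro haar_unitary_axioms.intro conj_field_axioms assms)
  note [measurable] = measurable_ident_normalized_haar
  have [measurable]: "(unitaries :: ('a ^ 'n ^ 'n) set) \<in> sets borel"
    by (rule borel_closed[OF closed_unitaries])
  show "prob_space (distr uG borel (\<lambda>x. x))"
    using haar by (intro prob_space.prob_space_distr) (auto simp: normalized_haar_def)
  show "AE g in distr uG borel (\<lambda>x. x). g \<in> unitaries"
    by (subst AE_distr_iff) (auto simp: space_normalized_haar)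
  fix g :: "'a ^ 'n ^ 'n" assume unitary_g: "g \<in> unitaries"
  show "distr (distr uG borel (\<lambda>x. x)) borel ((**) g) = distr uG borel (\<lambda>x. x)"
  proof (rule measure_eqI)
    fix A assume "A \<in> sets (distr (distr uG borel (\<lambda>x. x)) borel ((**) g))"
    then have borel_A [measurable]: "A \<in> sets borel" by simp
    show "emeasure (distr (distr uG borel (\<lambda>x. x)) borel ((**) g)) A
        = emeasure (distr uG borel (\<lambda>x. x)) A"
      using emeasure_normalized_haar_left[OF unitary_g borel_A]
      by (simp add: emeasure_distr space_normalized_haar vimage_def Int_def conj_commute)
  qed simp
qed simp

lemma measurable_normalized_haar:
  assumes "R \<in> M \<rightarrow>\<^sub>M uG" shows "R \<in> M \<rightarrow>\<^sub>M borel"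
  using measurable_compose[OF assms measurable_ident_normalized_haar] .

lemma haar_unitary_distr:
  assumes measurable_R: "R \<in> M \<rightarrow>\<^sub>M uG" and "distr M uG R = uG" and "2 \<le> CARD('n)"
  shows "haar_unitary star (distr M borel R)"
proof -
  have "distr uG borel (\<lambda>x. x) = distr (distr M uG R) borel (\<lambda>x. x)" by (simp only: assms(2))
  also have "\<dots> = distr M borel R"
    using distr_distr[OF measurable_ident_normalized_haar measurable_R] by (simp add: comp_def)
  finally show ?thesis using haar_unitary_distr_ident assms(3) by simp
qed

end

theorem haar_frame_concentration:
  fixes uG :: "('a ^ 'n ^ 'n) measure" and b :: "'i \<Rightarrow> 'a ^ 'n" and \<phi> :: "'a ^ 'n \<Rightarrow> real"
  assumes eps_pos: "0 < \<epsilon>" and delta_pos: "0 < \<delta>"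
    and card_I: "card I = CARD('n)" "2 \<le> card I" "2 / (\<delta>\<^sup>2 * \<epsilon>) \<le> real (card I)"
    and orthonormal_b: "orthonormal_family I b"
    and haar: "normalized_haar unitaries uG"
    and measurable_R [measurable]: "R \<in> M \<rightarrow>\<^sub>M uG" and distr_R: "distr M uG R = uG"
    and measurable_phi: "\<phi> \<in> borel_measurable uniform_sphere"
    and integrable_phi_power2: "integrable uniform_sphere (\<lambda>x. (\<phi> x)\<^sup>2)"
  shows "\<P>(\<omega> in M. \<bar>(1 / real (card I)) * (\<Sum>i\<in>I. \<phi> (R \<omega> *v b i))
      - prob_space.expectation uniform_sphere \<phi>\<bar>
            \<le> \<delta> * sqrt (prob_space.variance uniform_sphere \<phi>)) \<ge> 1 - \<epsilon>"
proof -
  interpret H: haar_unitary star "distr M borel R"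
    using haar_unitary_distr[OF haar measurable_R distr_R] card_I by simp
  note [measurable] = measurable_normalized_haar[OF haar measurable_R]
  obtain \<phi>' where [measurable]: "\<phi>' \<in> borel_measurable borel"
    and extension: "\<And>x. norm x = 1 \<Longrightarrow> \<phi>' x = \<phi> x"
    using ex_borel_extension_sphere[OF measurable_phi] by blast
  have "square_integrable sphere_law \<phi>'"
    using integrable_phi_power2 integrable_sphere_law_iff[of "\<lambda>x. (\<phi>' x)\<^sup>2" "\<lambda>x. (\<phi> x)\<^sup>2"]
    by (simp add: square_integrable_def extension)
  moreover have mean_eq: "integral\<^sup>L sphere_law \<phi>' = integral\<^sup>L uniform_sphere \<phi>"
    by (rule integral_sphere_law_eq) (simp_all add: extension)
  moreover have "(\<integral>x. (\<phi>' x - m)\<^sup>2 \<partial>sphere_law) = (\<integral>x. (\<phi> x - m)\<^sup>2 \<partial>uniform_sphere)" for m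
    by (rule integral_sphere_law_eq) (simp_all add: extension)
  ultimately have "1 - \<epsilon> \<le> measure (distr M borel R)
      {S. \<bar>(1 / real (card I)) * (\<Sum>i\<in>I. \<phi>' (S *v b i)) - integral\<^sup>L uniform_sphere \<phi>\<bar>
        \<le> \<delta> * sqrt (prob_space.variance uniform_sphere \<phi>)}"
    using H.frame_concentration[of I b \<phi>' \<epsilon> \<delta>] orthonormal_b card_I eps_pos delta_pos by simp
  also have "\<dots> = \<P>(\<omega> in M. \<bar>(1 / real (card I)) * (\<Sum>i\<in>I. \<phi>' (R \<omega> *v b i))
      - integral\<^sup>L uniform_sphere \<phi>\<bar>
        \<le> \<delta> * sqrt (prob_space.variance uniform_sphere \<phi>))"
    by (subst measure_distr) (auto simp: vimage_def Int_def conj_commute)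
  also have "\<dots> = \<P>(\<omega> in M. \<bar>(1 / real (card I)) * (\<Sum>i\<in>I. \<phi> (R \<omega> *v b i))
      - integral\<^sup>L uniform_sphere \<phi>\<bar>
        \<le> \<delta> * sqrt (prob_space.variance uniform_sphere \<phi>))"
  proof -
    have "\<phi>' (R \<omega> *v b i) = \<phi> (R \<omega> *v b i)" if "\<omega> \<in> space M" "i \<in> I" for \<omega> i
    proof (rule extension)
      have "R \<omega> \<in> unitaries"
        using measurable_space[OF measurable_R that(1)] by (simp add: space_normalized_haar[OF haar])
      then show "norm (R \<omega> *v b i) = 1"
        using norm_orthonormal_family[OF orthonormal_b that(2)] by simp
    qed
    then show ?thesis by (intro arg_cong[of _ _ "measure M"]) auto
  qed
  finally show ?thesis .
qed

end

lemma conj_field_real: "conj_field (\<lambda>x :: real. x)"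
proof (rule conj_field.intro)
  show "linear (\<lambda>x :: real. x)" by (rule bounded_linear.linear[OF bounded_linear_ident])
qed (simp_all add: power2_eq_square)

lemma conj_field_complex: "conj_field cnj"
proof (rule conj_field.intro)
  show "linear cnj" by (rule bounded_linear.linear[OF bounded_linear_cnj])
  show "a * cnj a = of_real ((norm a)\<^sup>2)" for a by (rule complex_norm_square[symmetric])
qed simp_all

lemma orthogonal_group_eq_unitaries: "orthogonal_group = conj_field.unitaries (\<lambda>x :: real. x)"
  by (simp add: orthogonal_group_def orthogonal_matrix_def transpose_def
      conj_field.unitaries_def[OF conj_field_real]
      conj_field.adjoint_matrix_def[OF conj_field_real])

lemma unitary_group_eq_unitaries: "unitary_group = conj_field.unitaries cnj"
  by (simp add: unitary_group_def conj_transpose_def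
      conj_field.unitaries_def[OF conj_field_complex]
      conj_field.adjoint_matrix_def[OF conj_field_complex])

lemma herm_real_eq_inner: "conj_field.herm (\<lambda>x :: real. x) = (\<bullet>)"
  by (simp add: fun_eq_iff conj_field.herm_def[OF conj_field_real] inner_vec_def)

lemma herm_complex_eq_hermitian_inner: "conj_field.herm cnj = hermitian_inner"
  by (simp add: fun_eq_iff conj_field.herm_def[OF conj_field_complex] hermitian_inner_def)

theorem theorem1:
  fixes \<epsilon> \<delta> :: real and d :: nat
  assumes "\<epsilon> > 0" and "\<delta> > 0"
    and "d = CARD('n::finite)" and "d \<ge> 4" and "real d \<ge> 2 / (\<delta>\<^sup>2 * \<epsilon>)"
  shows
    "(\<forall>(b :: nat \<Rightarrow> real ^ 'n) (uG :: (real ^ 'n ^ 'n) measure)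
        (M :: 'w measure) (R :: 'w \<Rightarrow> real ^ 'n ^ 'n) (\<phi> :: real ^ 'n \<Rightarrow> real).
        real_orthonormal_basis d b \<longrightarrow>
        normalized_haar orthogonal_group uG \<longrightarrow>
        prob_space M \<longrightarrow> R \<in> M \<rightarrow>\<^sub>M uG \<longrightarrow> distr M uG R = uG \<longrightarrow>
        \<phi> \<in> borel_measurable uniform_sphere \<longrightarrow> integrable uniform_sphere (\<lambda>x. (\<phi> x)\<^sup>2) \<longrightarrow>
        \<P>(\<omega> in M. \<bar>(1 / real d) * (\<Sum>j=1..d. \<phi> (R \<omega> *v b j)) - prob_space.expectation uniform_sphere \<phi>\<bar>
            \<le> \<delta> * sqrt (prob_space.variance uniform_sphere \<phi>)) \<ge> 1 - \<epsilon>)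
   \<and> (\<forall>(b :: nat \<Rightarrow> complex ^ 'n) (uG :: (complex ^ 'n ^ 'n) measure)
        (M :: 'w measure) (R :: 'w \<Rightarrow> complex ^ 'n ^ 'n) (\<phi> :: complex ^ 'n \<Rightarrow> real).
        complex_orthonormal_basis d b \<longrightarrow>
        normalized_haar unitary_group uG \<longrightarrow>
        prob_space M \<longrightarrow> R \<in> M \<rightarrow>\<^sub>M uG \<longrightarrow> distr M uG R = uG \<longrightarrow>
        \<phi> \<in> borel_measurable uniform_sphere \<longrightarrow> integrable uniform_sphere (\<lambda>x. (\<phi> x)\<^sup>2) \<longrightarrow>
        \<P>(\<omega> in M. \<bar>(1 / real d) * (\<Sum>j=1..d. \<phi> (R \<omega> *v b j)) - prob_space.expectation uniform_sphere \<phi>\<bar>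
            \<le> \<delta> * sqrt (prob_space.variance uniform_sphere \<phi>)) \<ge> 1 - \<epsilon>)"
proof (intro conjI allI impI, goal_cases)
  case (1 b uG M R \<phi>)
  then show ?case
    using conj_field.haar_frame_concentration[OF conj_field_real, of \<epsilon> \<delta> "{1..d}" b uG R M \<phi>] assms
    by (simp add: orthogonal_group_eq_unitaries herm_real_eq_inner real_orthonormal_basis_def
        conj_field.orthonormal_family_def[OF conj_field_real])
next
  case (2 b uG M R \<phi>)
  then show ?case
    using conj_field.haar_frame_concentration[OF conj_field_complex, of \<epsilon> \<delta> "{1..d}" b uG R M \<phi>]
        assms
    by (simp add: unitary_group_eq_unitaries herm_complex_eq_hermitian_inner
        complex_orthonormal_basis_def
        conj_field.orthonormal_family_def[OF conj_field_complex])
qed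

end
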